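(* Let $n\ge 1$ and let $P_1(z)=a_nz^n+a_{n-1}z^{n-1}+\cdots+a_0$ and $P_0(z)=b_nz^n+b_{n-1}z^{n-1}+\cdots+b_0$ be non-constant polynomials with complex coefficients, $a_n\neq 0$, $b_n\neq 0$. Let $h_1$ and $h_0$ be entire functions, not identically zero, satisfying $\rho(h_1)<\deg P_1$ and $\rho(h_0)<\deg P_0$. Suppose that $P_1(z)-cP_0(z)$ is a constant for some real $c\geq 1$, and that $\rho(h_1)<\mu(h_0)\leq \frac{1}{2}$. Then every non-trivial solution $f$ of the differential equation $$f''+h_1(z)e^{P_1(z)}f'+h_0(z)e^{P_0(z)}f=0$$ is of infinite order.
   Context: All solutions of this equation are entire functions. For an entire function $g$, with $M(r,g)=\max_{|z|=r}|g(z)|$, the order is $\rho(g)=\limsup_{r\to\infty}\frac{\log^+\log^+ M(r,g)}{\log r}$ and the lower order is $\mu(g)=\liminf_{r\to\infty}\frac{\log^+\log^+ M(r,g)}{\log r}$. A solution is non-trivial if it is not identically zero; it has infinite order if $\rho(f)=\infty$. *)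

theory Defs
  imports "HOL-Complex_Analysis.Complex_Analysis" "HOL-Computational_Algebra.Polynomial"
begin

definition max_modulus :: "(complex \<Rightarrow> complex) \<Rightarrow> real \<Rightarrow> real" where
  "max_modulus g r = Sup ((\<lambda>z. norm (g z)) ` sphere 0 r)"

definition log_plus :: "real \<Rightarrow> real" where
  "log_plus x = (if x \<le> 1 then 0 else ln x)"

definition entire_order :: "(complex \<Rightarrow> complex) \<Rightarrow> ereal" where
  "entire_order g = Limsup at_top (\<lambda>r::real. ereal (log_plus (log_plus (max_modulus g r)) / ln r))"

definition entire_lower_order :: "(complex \<Rightarrow> complex) \<Rightarrow> ereal" where
  "entire_lower_order g = Liminf at_top (\<lambda>r::real. ereal (log_plus (log_plus (max_modulus g r)) / ln r))"

end

theory Submission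
  imports Defs "HOL-Real_Asymp.Real_Asymp"
begin

text \<open>
  Suppose that \<open>f\<close> has finite order. Dividing the equation by \<open>f\<close> expresses \<open>h0 * exp P0\<close> through
  \<open>f''/f\<close>, \<open>f'/f\<close> and \<open>h1 * exp P1\<close>. Around every point \<open>z0\<close> far out there is a circle, of radius
  at most a prescribed negative power of \<open>|z0|\<close>, on which the two quotients are bounded by a power
  of \<open>|z0|\<close>. If \<open>Re P0 z0 = 0\<close>, then both exponentials are bounded above and below on that circle,
  because \<open>Re P1\<close> and \<open>c * Re P0\<close> differ by a constant. So \<open>h0\<close> is essentially bounded by \<open>h1\<close>
  there and, by the maximum principle, at \<open>z0\<close>. As \<open>h0\<close> has order less than \<open>deg P0\<close>, a
  Phragmen-Lindelof argument propagates the bound from the curves \<open>Re P0 = 0\<close> to the whole plane.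
  The comparison functions are the principal powers \<open>Q powr t\<close> of \<open>Q = P0\<close> and \<open>Q = - P0\<close> with
  \<open>t < 1\<close>, whose real part dominates a multiple of \<open>|Q| powr t\<close> wherever \<open>Re Q \<ge> 0\<close>; so the
  components of the regions \<open>Re Q > 0\<close> need not be described. Hence the order of \<open>h0\<close> is at most the
  order of \<open>h1\<close>, a contradiction.
\<close>

subsection \<open>Order and growth\<close>

lemma norm_le_max_modulus:
  assumes "continuous_on (sphere 0 (norm z)) g"
  shows "norm (g z) \<le> max_modulus g (norm z)"
proof -
  have "compact ((\<lambda>z. norm (g z)) ` sphere 0 (norm z))"
    using assms by (intro compact_continuous_image continuous_intros) auto
  then have "bdd_above ((\<lambda>z. norm (g z)) ` sphere 0 (norm z))"
    by (intro bounded_imp_bdd_above compact_imp_bounded)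
  then show ?thesis
    unfolding max_modulus_def by (intro cSup_upper) auto
qed

lemma max_modulus_le:
  assumes "r \<ge> 0" "\<And>z. norm z = r \<Longrightarrow> norm (g z) \<le> B"
  shows "max_modulus g r \<le> B"
proof -
  have "complex_of_real r \<in> sphere 0 r"
    using assms(1) by simp
  then show ?thesis
    unfolding max_modulus_def using assms(2) by (intro cSup_least) auto
qed

lemma log_plus_nonneg: "log_plus x \<ge> 0"
  by (simp add: log_plus_def)

lemma log_plus_le_iff:
  assumes "y \<ge> 0"
  shows "log_plus x \<le> y \<longleftrightarrow> x \<le> exp y"
proof (cases "x \<le> 1")
  case True
  then show ?thesis
    using assms order_trans[of x 1 "exp y"] by (simp add: log_plus_def)
next
  case False
  then show ?thesis
    using ln_le_cancel_iff[of x "exp y"] by (simp add: log_plus_def)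
qed

lemma entire_lower_order_le_entire_order: "entire_lower_order g \<le> entire_order g"
  unfolding entire_lower_order_def entire_order_def
  by (rule Liminf_le_Limsup) simp

lemma entire_order_nonneg: "entire_order g \<ge> 0"
proof -
  have "\<forall>\<^sub>F r in at_top. ereal 0 \<le> ereal (log_plus (log_plus (max_modulus g r)) / ln r)"
    using eventually_gt_at_top[of "1::real"]
    by eventually_elim (auto intro!: divide_nonneg_nonneg log_plus_nonneg)
  then have "Limsup at_top (\<lambda>r::real. ereal 0) \<le> entire_order g"
    unfolding entire_order_def by (rule Limsup_mono)
  then show ?thesis by (simp add: Limsup_const zero_ereal_def)
qed

lemma eventually_norm_le_exp_powr_if_entire_order_less:
  assumes cont: "continuous_on UNIV g" and order: "entire_order g < ereal s"
  shows "\<forall>\<^sub>F z in at_infinity. norm (g z) \<le> exp (norm z powr s)"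
proof -
  have "\<forall>\<^sub>F r in at_top. ereal (log_plus (log_plus (max_modulus g r)) / ln r) < ereal s"
    using order unfolding entire_order_def by (rule Limsup_lessD)
  then have "\<forall>\<^sub>F r in at_top. max_modulus g r \<le> exp (r powr s)"
    using eventually_gt_at_top[of "1::real"]
  proof eventually_elim
    case (elim r)
    then have log_log_le: "log_plus (log_plus (max_modulus g r)) \<le> s * ln r"
      by (simp add: pos_divide_less_eq)
    then have "s * ln r \<ge> 0"
      using log_plus_nonneg order_trans by blast
    with log_log_le have "max_modulus g r \<le> exp (exp (s * ln r))"
      by (simp add: log_plus_le_iff)
    with elim show ?case by (simp add: powr_def)
  qed
  then have "\<forall>\<^sub>F z::complex in at_infinity. max_modulus g (norm z) \<le> exp (norm z powr s)"
    by (rule eventually_compose_filterlim[OF _ filterlim_norm_at_top])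
  then show ?thesis
  proof eventually_elim
    case (elim z)
    have "norm (g z) \<le> max_modulus g (norm z)"
      using cont by (intro norm_le_max_modulus) (auto intro: continuous_on_subset)
    with elim show ?case by linarith
  qed
qed

lemma eventually_norm_le_exp_power_if_entire_order_finite:
  assumes "continuous_on UNIV g" "entire_order g \<noteq> \<infinity>"
  obtains K :: nat where "\<forall>\<^sub>F z in at_infinity. norm (g z) \<le> exp (norm z ^ K)"
proof -
  obtain K :: nat where "entire_order g < ereal (real K)"
    using assms(2) less_PInf_Ex_of_nat[of "entire_order g"] by auto
  from eventually_norm_le_exp_powr_if_entire_order_less[OF assms(1) this]
  have "\<forall>\<^sub>F z in at_infinity. norm (g z) \<le> exp (norm z ^ K)"
    using eventually_not_equal_at_infinity[of 0]
    by eventually_elim (simp add: powr_realpow)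
  then show thesis by (rule that)
qed

lemma entire_order_le:
  assumes s_pos: "s > 0"
    and growth: "\<forall>\<^sub>F z in at_infinity. norm (g z) \<le> B * exp (C * norm z powr s)"
  shows "entire_order g \<le> ereal s"
proof -
  define b where "b = ln (max 1 B)"
  define c where "c = max 1 C"
  have b_bounds: "b \<ge> 0" "B \<le> exp b" and c_bounds: "c \<ge> 1" "C \<le> c"
    by (auto simp: b_def c_def)
  obtain R where growth_beyond_R: "\<And>z. norm z \<ge> R \<Longrightarrow> norm (g z) \<le> B * exp (C * norm z powr s)"
    using growth unfolding eventually_at_infinity by blast
  have "\<forall>\<^sub>F r in at_top. ereal (log_plus (log_plus (max_modulus g r)) / ln r)
      \<le> ereal (ln (b + c * r powr s) / ln r)"
    using eventually_gt_at_top[of "1::real"] eventually_ge_at_top[of R]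
  proof eventually_elim
    case (elim r)
    have "1 * 1 \<le> c * r powr s"
      using c_bounds elim s_pos by (intro mult_mono ge_one_powr_ge_zero) auto
    then have ge_1: "b + c * r powr s \<ge> 1" using b_bounds by simp
    have "max_modulus g r \<le> B * exp (C * r powr s)"
      using elim growth_beyond_R by (intro max_modulus_le) auto
    also have "\<dots> \<le> exp b * exp (c * r powr s)"
      using b_bounds c_bounds by (intro mult_mono) (auto intro: mult_right_mono)
    finally have "log_plus (max_modulus g r) \<le> b + c * r powr s"
      using ge_1 by (simp add: log_plus_le_iff exp_add)
    then have "log_plus (log_plus (max_modulus g r)) \<le> ln (b + c * r powr s)"
      using ge_1 by (simp add: log_plus_le_iff)
    with elim show ?case by (simp add: divide_right_mono)
  qed
  then have "entire_order g \<le> Limsup at_top (\<lambda>r. ereal (ln (b + c * r powr s) / ln r))"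
    unfolding entire_order_def by (rule Limsup_mono)
  also have "((\<lambda>r. ln (b + c * r powr s) / ln r) \<longlongrightarrow> s) at_top"
    using s_pos c_bounds by real_asymp
  then have "Limsup at_top (\<lambda>r. ereal (ln (b + c * r powr s) / ln r)) = ereal s"
    by (intro lim_imp_Limsup) auto
  finally show ?thesis .
qed

subsection \<open>Splitting off zeros\<close>

lemma maximum_modulus_cball:
  assumes hol: "h holomorphic_on cball p r"
    and sphere_le: "\<And>w. w \<in> sphere p r \<Longrightarrow> norm (h w) \<le> B" and z_in: "z \<in> cball p r"
  shows "norm (h z) \<le> B"
proof (rule maximum_modulus_frontier[of h "cball p r"])
  show "h holomorphic_on interior (cball p r)"
    using hol interior_subset by (rule holomorphic_on_subset)
  show "continuous_on (closure (cball p r)) h"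
    using hol by (simp add: holomorphic_on_imp_continuous_on)
qed (use sphere_le z_in in auto)

lemma norm_prod_mset_le:
  fixes f :: "'a \<Rightarrow> 'b::real_normed_field" and r :: real
  assumes "\<And>a. a \<in># A \<Longrightarrow> norm (f a) \<le> r"
  shows "norm (\<Prod>a\<in>#A. f a) \<le> r ^ size A"
  using assms
proof (induction A)
  case (add a A)
  have "norm (f a) * norm (\<Prod>a\<in>#A. f a) \<le> r * r ^ size A"
    using add by (intro mult_mono') auto
  then show ?case by (simp add: norm_mult)
qed simp

lemma norm_prod_mset_ge:
  fixes f :: "'a \<Rightarrow> 'b::real_normed_field" and r :: real
  assumes r_nonneg: "r \<ge> 0" and r_le: "\<And>a. a \<in># A \<Longrightarrow> r \<le> norm (f a)"
  shows "r ^ size A \<le> norm (\<Prod>a\<in>#A. f a)"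
  using r_le
proof (induction A)
  case (add a A)
  have "r * r ^ size A \<le> norm (f a) * norm (\<Prod>a\<in>#A. f a)"
    using add r_nonneg by (intro mult_mono) auto
  then show ?case by (simp add: norm_mult)
qed simp

lemma norm_sum_mset_le:
  fixes f :: "'a \<Rightarrow> 'b::real_normed_vector" and b :: real
  assumes "\<And>a. a \<in># A \<Longrightarrow> norm (f a) \<le> b"
  shows "norm (\<Sum>a\<in>#A. f a) \<le> size A * b"
  using assms
proof (induction A)
  case (add a A)
  then show ?case
    using norm_triangle_mono[of "f a" b "\<Sum>a\<in>#A. f a" "size A * b"] by (simp add: distrib_right)
qed simp

definition zero_factorization ::
  "complex set \<Rightarrow> (complex \<Rightarrow> complex) \<Rightarrow> complex multiset \<Rightarrow> (complex \<Rightarrow> complex) \<Rightarrow> bool" where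
  "zero_factorization S f Z g \<longleftrightarrow> g holomorphic_on S \<and> (\<forall>z\<in>S. f z = (\<Prod>a\<in>#Z. z - a) * g z)"

lemma zero_factorization_add_mset:
  assumes fac: "zero_factorization S f Z g" and "open S" "g a = 0"
  obtains h where "zero_factorization S f (add_mset a Z) h"
proof -
  define h where "h z = (if z = a then deriv g a else (g z - g a) / (z - a))" for z
  have "h holomorphic_on S"
    unfolding h_def using assms by (intro pole_lemma_open) (auto simp: zero_factorization_def)
  moreover have "g z = (z - a) * h z" for z
    using \<open>g a = 0\<close> by (auto simp: h_def)
  ultimately have "zero_factorization S f (add_mset a Z) h"
    using fac by (simp add: zero_factorization_def mult_ac)
  then show thesis by (rule that)
qed

context
  fixes S :: "complex set" and f g :: "complex \<Rightarrow> complex" and Z :: "complex multiset"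
    and p :: complex and r M :: real
  assumes fac: "zero_factorization S f Z g" and zeros: "set_mset Z \<subseteq> cball p r"
    and r_pos: "r > 0" and subset: "cball p (3 * r) \<subseteq> S"
    and sphere_le: "\<And>z. z \<in> sphere p (3 * r) \<Longrightarrow> norm (f z) \<le> M"
begin

lemma norm_cofactor_le:
  assumes z_in: "z \<in> cball p (3 * r)"
  shows "(2 * r) ^ size Z * norm (g z) \<le> M"
proof -
  have "norm (g z) \<le> M / (2 * r) ^ size Z"
  proof (rule maximum_modulus_cball[OF _ _ z_in])
    show "g holomorphic_on cball p (3 * r)"
      using fac subset holomorphic_on_subset by (auto simp: zero_factorization_def)
    fix w assume w_on_sphere: "w \<in> sphere p (3 * r)"
    then have "w \<in> S" using subset by auto
    have "2 * r \<le> norm (w - a)" if "a \<in># Z" for a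
      using zeros that w_on_sphere dist_triangle[of p w a]
      by (auto simp: dist_norm norm_minus_commute)
    then have "(2 * r) ^ size Z * norm (g w) \<le> norm (\<Prod>a\<in>#Z. w - a) * norm (g w)"
      using r_pos by (intro mult_right_mono norm_prod_mset_ge) auto
    also have "\<dots> = norm (f w)"
      using fac \<open>w \<in> S\<close> by (simp add: zero_factorization_def norm_mult)
    also have "\<dots> \<le> M" using w_on_sphere by (rule sphere_le)
    finally show "norm (g w) \<le> M / (2 * r) ^ size Z" using r_pos by (simp add: field_simps)
  qed
  then show ?thesis using r_pos by (simp add: field_simps)
qed

lemma norm_center_le_cofactor: "norm (f p) \<le> r ^ size Z * norm (g p)"
proof -
  have "p \<in> S" using subset r_pos by auto
  then have "norm (f p) = norm (\<Prod>a\<in>#Z. p - a) * norm (g p)"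
    using fac by (simp add: zero_factorization_def norm_mult)
  also have "\<dots> \<le> r ^ size Z * norm (g p)"
    using zeros by (intro mult_right_mono norm_prod_mset_le) (auto simp: dist_norm)
  finally show ?thesis .
qed

lemma two_power_size_zeros_le: "2 ^ size Z * norm (f p) \<le> M"
proof -
  have "2 ^ size Z * norm (f p) \<le> 2 ^ size Z * (r ^ size Z * norm (g p))"
    using norm_center_le_cofactor by (rule mult_left_mono) simp
  also have "\<dots> = (2 * r) ^ size Z * norm (g p)"
    by (simp add: power_mult_distrib)
  also have "\<dots> \<le> M" using r_pos by (intro norm_cofactor_le) auto
  finally show ?thesis .
qed

lemma norm_cofactor_le_center:
  assumes z_in: "z \<in> cball p (3 * r)"
  shows "norm (f p) * norm (g z) \<le> M * norm (g p)"
proof -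
  have "norm (f p) * norm (g z) \<le> r ^ size Z * norm (g p) * norm (g z)"
    using norm_center_le_cofactor by (rule mult_right_mono) simp
  also have "\<dots> \<le> (2 * r) ^ size Z * norm (g p) * norm (g z)"
    using r_pos by (intro mult_right_mono power_mono) auto
  also have "\<dots> = (2 * r) ^ size Z * norm (g z) * norm (g p)" by simp
  also have "\<dots> \<le> M * norm (g p)"
    using norm_cofactor_le[OF z_in] by (rule mult_right_mono) simp
  finally show ?thesis .
qed

end

lemma exists_zero_factorization_zero_free:
  assumes hol: "f holomorphic_on S" and "open S" and subset: "cball p (3 * r) \<subseteq> S"
    and r_pos: "r > 0" and "f p \<noteq> 0"
  obtains Z g where "zero_factorization S f Z g" "set_mset Z \<subseteq> cball p r"
    "\<And>z. z \<in> cball p r \<Longrightarrow> g z \<noteq> 0"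
proof -
  \<comment> \<open>The number of factors is bounded, so a factorization of maximal size exists; its cofactor has
    no zero left to split off.\<close>
  define P where "P n \<longleftrightarrow> (\<exists>Z g. zero_factorization S f Z g \<and> set_mset Z \<subseteq> cball p r \<and> size Z = n)"
    for n
  have "bounded (f ` sphere p (3 * r))"
    using subset by (intro compact_imp_bounded compact_continuous_image
        continuous_on_subset[OF holomorphic_on_imp_continuous_on[OF hol]]) auto
  then obtain M where sphere_le: "\<And>w. w \<in> f ` sphere p (3 * r) \<Longrightarrow> norm w \<le> M"
    unfolding bounded_iff by blast
  obtain B :: nat where less_two_power_B: "M / norm (f p) < 2 ^ B"
    using real_arch_pow[of 2 "M / norm (f p)"] by auto
  have size_le_B: "n \<le> B" if "P n" for n
  proof -
    obtain Z g where fac: "zero_factorization S f Z g" "set_mset Z \<subseteq> cball p r" "size Z = n"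
      using \<open>P n\<close> unfolding P_def by blast
    have "2 ^ n * norm (f p) \<le> M"
      using two_power_size_zeros_le[OF fac(1,2) r_pos subset] sphere_le fac(3) by auto
    then have "2 ^ n \<le> M / norm (f p)"
      using \<open>f p \<noteq> 0\<close> by (simp add: field_simps)
    with less_two_power_B have "(2::real) ^ n < 2 ^ B" by linarith
    then show ?thesis by simp
  qed
  have "P 0" using hol by (auto simp: P_def zero_factorization_def)
  then obtain n where "P n" and maximal: "\<And>m. P m \<Longrightarrow> m \<le> n"
    using Nat.ex_has_greatest_nat[of P 0 B] size_le_B by blast
  then obtain Z g where fac: "zero_factorization S f Z g" "set_mset Z \<subseteq> cball p r" "size Z = n"
    unfolding P_def by blast
  have "g z \<noteq> 0" if "z \<in> cball p r" for z
  proof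
    assume "g z = 0"
    then obtain h where "zero_factorization S f (add_mset z Z) h"
      using zero_factorization_add_mset fac(1) \<open>open S\<close> by blast
    then have "P (Suc n)"
      using fac(2,3) that by (auto simp: P_def intro!: exI[of _ "add_mset z Z"])
    then show False using maximal by fastforce
  qed
  with fac(1,2) show thesis by (rule that)
qed

subsection \<open>Logarithmic derivatives\<close>

lemma has_field_derivative_prod_mset_linear:
  fixes z :: "'a::real_normed_field"
  assumes "z \<notin># Z"
  shows "((\<lambda>z. \<Prod>a\<in>#Z. z - a) has_field_derivative
           (\<Prod>a\<in>#Z. z - a) * (\<Sum>a\<in>#Z. 1 / (z - a))) (at z)"
  using assms
proof (induction Z)
  case (add a Z)
  have "((\<lambda>z. (z - a) * (\<Prod>a\<in>#Z. z - a)) has_field_derivative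
      (\<Prod>a\<in>#Z. z - a) + (\<Prod>a\<in>#Z. z - a) * (\<Sum>a\<in>#Z. 1 / (z - a)) * (z - a)) (at z)"
    using add by (auto intro!: derivative_eq_intros)
  also have "(\<Prod>a\<in>#Z. z - a) + (\<Prod>a\<in>#Z. z - a) * (\<Sum>a\<in>#Z. 1 / (z - a)) * (z - a)
      = (z - a) * (\<Prod>a\<in>#Z. z - a) * (1 / (z - a) + (\<Sum>a\<in>#Z. 1 / (z - a)))"
    using add.prems by (simp add: distrib_left)
  finally show ?case by simp
qed simp

lemma logderiv_zero_factorization:
  assumes fac: "zero_factorization S f Z g" and "open S" and z_regular: "z \<in> S" "z \<notin># Z" "g z \<noteq> 0"
  shows "f z \<noteq> 0" "deriv f z / f z = (\<Sum>a\<in>#Z. 1 / (z - a)) + deriv g z / g z"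
proof -
  let ?P = "\<lambda>z. \<Prod>a\<in>#Z. z - a"
  have f_z: "f z = ?P z * g z" using fac z_regular by (simp add: zero_factorization_def)
  have prod_nonzero: "?P z \<noteq> 0" using z_regular(2) by auto
  show "f z \<noteq> 0" using f_z prod_nonzero z_regular(3) by simp
  have "(g has_field_derivative deriv g z) (at z)"
    using fac \<open>open S\<close> z_regular(1) by (auto simp: zero_factorization_def intro: holomorphic_derivI)
  from DERIV_mult[OF has_field_derivative_prod_mset_linear[OF z_regular(2)] this]
  have "((\<lambda>z. ?P z * g z) has_field_derivative
      ?P z * (\<Sum>a\<in>#Z. 1 / (z - a)) * g z + deriv g z * ?P z) (at z)" .
  then have "(f has_field_derivative ?P z * (\<Sum>a\<in>#Z. 1 / (z - a)) * g z + deriv g z * ?P z) (at z)"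
    by (rule has_field_derivative_transform_within_open[OF _ \<open>open S\<close> z_regular(1)])
      (use fac in \<open>simp add: zero_factorization_def\<close>)
  then have "deriv f z = ?P z * (\<Sum>a\<in>#Z. 1 / (z - a)) * g z + deriv g z * ?P z"
    by (rule DERIV_imp_deriv)
  then show "deriv f z / f z = (\<Sum>a\<in>#Z. 1 / (z - a)) + deriv g z / g z"
    using prod_nonzero z_regular(3) by (simp add: f_z field_simps)
qed

lemma norm_less_norm_of_real_diff:
  assumes "b > 0" "Re w < b"
  shows "norm w < norm (2 * of_real b - w)"
proof -
  have "(norm (2 * of_real b - w))\<^sup>2 - (norm w)\<^sup>2 = 4 * b * (b - Re w)"
    unfolding cmod_power2 by (simp add: power2_eq_square algebra_simps)
  also have "\<dots> > 0" using assms by simp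
  finally show ?thesis by (simp add: power2_less_imp_less)
qed

lemma Borel_Caratheodory_unit_disc:
  assumes hol: "f holomorphic_on ball 0 1" and zero_at_0: "f 0 = 0"
    and Re_less: "\<And>w. norm w < 1 \<Longrightarrow> Re (f w) < b" and z_in: "norm z < 1"
  shows "norm (f z) \<le> 2 * b * norm z / (1 - norm z)"
proof -
  have b_pos: "b > 0" using Re_less[of 0] zero_at_0 by simp
  define \<phi> where "\<phi> w = f w / (2 * of_real b - f w)" for w
  have norm_less: "norm (f w) < norm (2 * of_real b - f w)" if "norm w < 1" for w
    using b_pos Re_less[OF that] by (rule norm_less_norm_of_real_diff)
  have "norm (\<phi> z) \<le> norm z"
  proof (rule Schwarz_Lemma(1))
    show "\<phi> holomorphic_on ball 0 1"
      unfolding \<phi>_def using norm_less by (intro holomorphic_intros hol) force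
    show "norm (\<phi> w) < 1" if "norm w < 1" for w
      using norm_less[OF that] norm_ge_zero[of "f w"]
      by (simp add: \<phi>_def norm_divide divide_less_eq)
  qed (use z_in zero_at_0 in \<open>auto simp: \<phi>_def\<close>)
  then have "norm (f z) \<le> norm z * norm (2 * of_real b - f z)"
    using norm_less[OF z_in] norm_ge_zero[of "f z"]
    by (simp add: \<phi>_def norm_divide divide_le_eq split: if_splits)
  also have "\<dots> \<le> norm z * (2 * b + norm (f z))"
    using norm_triangle_ineq4[of "2 * of_real b" "f z"] b_pos by (intro mult_left_mono) auto
  finally show ?thesis using z_in by (simp add: pos_le_divide_eq algebra_simps)
qed

theorem Borel_Caratheodory:
  assumes hol: "f holomorphic_on ball p R" and Re_le: "\<And>w. w \<in> ball p R \<Longrightarrow> Re (f w) \<le> A"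
    and z_in: "z \<in> ball p R"
  shows "norm (f z - f p) \<le> 2 * (A - Re (f p)) * dist p z / (R - dist p z)"
proof (rule tendsto_lowerbound)
  have R_pos: "R > 0" using z_in zero_le_dist[of p z] unfolding mem_ball by linarith
  define F where "F w = f (p + of_real R * w) - f p" for w
  have in_ball: "p + of_real R * w \<in> ball p R" if "norm w < 1" for w
    using that R_pos by (simp add: dist_norm norm_mult)
  have "f \<circ> (\<lambda>w. p + of_real R * w) holomorphic_on ball 0 1"
    using in_ball by (intro holomorphic_on_compose_gen[OF _ hol] holomorphic_intros) auto
  then have hol_F: "F holomorphic_on ball 0 1"
    unfolding F_def by (intro holomorphic_intros) (simp add: o_def)
  define \<xi> where "\<xi> = (z - p) / of_real R"
  have \<xi>_props: "norm \<xi> = dist p z / R" "norm \<xi> < 1" "F \<xi> = f z - f p"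
    using z_in R_pos by (auto simp: \<xi>_def F_def norm_divide dist_norm norm_minus_commute)
  have bound_if_greater: "norm (f z - f p) \<le> 2 * (B - Re (f p)) * dist p z / (R - dist p z)"
    if "B > A" for B
  proof -
    have "norm (F \<xi>) \<le> 2 * (B - Re (f p)) * norm \<xi> / (1 - norm \<xi>)"
    proof (rule Borel_Caratheodory_unit_disc[OF hol_F _ _ \<xi>_props(2)])
      show "Re (F w) < B - Re (f p)" if "norm w < 1" for w
        using Re_le[OF in_ball[OF that]] \<open>B > A\<close> by (simp add: F_def)
    qed (simp add: F_def)
    also have "norm \<xi> / (1 - norm \<xi>) = dist p z / (R - dist p z)"
      using R_pos z_in by (simp add: \<xi>_props(1) field_simps)
    then have "2 * (B - Re (f p)) * norm \<xi> / (1 - norm \<xi>)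
        = 2 * (B - Re (f p)) * dist p z / (R - dist p z)"
      by (simp flip: times_divide_eq_right)
    finally show ?thesis unfolding \<xi>_props(3) .
  qed
  show "\<forall>\<^sub>F B in at_right A. norm (f z - f p) \<le> 2 * (B - Re (f p)) * dist p z / (R - dist p z)"
    using eventually_at_right_less[of A] by eventually_elim (rule bound_if_greater)
  show "((\<lambda>B. 2 * (B - Re (f p)) * dist p z / (R - dist p z))
      \<longlongrightarrow> 2 * (A - Re (f p)) * dist p z / (R - dist p z)) (at_right A)"
    using z_in by (intro tendsto_intros) auto
qed simp

corollary norm_deriv_le_if_Re_le:
  assumes hol: "f holomorphic_on ball p R" and Re_le: "\<And>w. w \<in> ball p R \<Longrightarrow> Re (f w) \<le> A"
    and z_in: "z \<in> ball p R"
  shows "norm (deriv f z) \<le> 8 * (A - Re (f p)) * R / (R - dist p z)\<^sup>2"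
proof -
  have R_pos: "R > 0" using z_in zero_le_dist[of p z] unfolding mem_ball by linarith
  have A_ge_Re: "A - Re (f p) \<ge> 0" using Re_le[of p] R_pos by simp
  define \<delta> where "\<delta> = (R - dist p z) / 2"
  have \<delta>_props: "\<delta> > 0" "dist p z + 2 * \<delta> = R" using z_in by (auto simp: \<delta>_def field_simps)
  have near: "dist p w \<le> R - \<delta>" if "w \<in> cball z \<delta>" for w
    using that dist_triangle[of p w z] \<delta>_props by simp
  then have subset: "cball z \<delta> \<subseteq> ball p R" using \<delta>_props(1) by fastforce
  have deriv_diff: "deriv (\<lambda>w. f w - f p) z = deriv f z"
    using hol z_in by (intro DERIV_imp_deriv) (auto intro!: derivative_eq_intros holomorphic_derivI)
  have "norm ((deriv ^^ 1) (\<lambda>w. f w - f p) z) \<le> fact 1 * (2 * (A - Re (f p)) * R / \<delta>) / \<delta> ^ 1"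
  proof (rule Cauchy_inequality)
    show "(\<lambda>w. f w - f p) holomorphic_on ball z \<delta>" "continuous_on (cball z \<delta>) (\<lambda>w. f w - f p)"
      using subset ball_subset_cball[of z \<delta>]
      by (intro holomorphic_intros holomorphic_on_subset[OF hol] continuous_intros
          continuous_on_subset[OF holomorphic_on_imp_continuous_on[OF hol]]; blast)+
    fix w assume "norm (z - w) = \<delta>"
    then have w_near: "w \<in> cball z \<delta>" by (simp add: dist_norm)
    then have "norm (f w - f p) \<le> 2 * (A - Re (f p)) * dist p w / (R - dist p w)"
      using subset by (intro Borel_Caratheodory[OF hol Re_le]) auto
    also have "\<dots> \<le> 2 * (A - Re (f p)) * R / \<delta>"
      using near[OF w_near] \<delta>_props A_ge_Re by (intro frac_le mult_mono) auto
    finally show "norm (f w - f p) \<le> 2 * (A - Re (f p)) * R / \<delta>" .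
  qed (rule \<delta>_props)
  then have "norm (deriv f z) \<le> 2 * (A - Re (f p)) * R / \<delta>\<^sup>2"
    by (simp add: deriv_diff power2_eq_square)
  then show ?thesis by (simp add: \<delta>_def power_divide algebra_simps)
qed

lemma exists_holomorphic_log:
  assumes hol: "g holomorphic_on S" and domain: "open S" "convex S" and nz: "\<And>z. z \<in> S \<Longrightarrow> g z \<noteq> 0"
  obtains G where "G holomorphic_on S" "\<And>z. z \<in> S \<Longrightarrow> exp (G z) = g z"
    "\<And>z. z \<in> S \<Longrightarrow> deriv G z = deriv g z / g z"
proof (cases "S = {}")
  case False
  then obtain G where hol_G: "G holomorphic_on S" and exp_G: "\<And>z. z \<in> S \<Longrightarrow> exp (G z) = g z"
    using holomorphic_logarithm_exists[OF domain(2,1) hol nz] by auto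
  have "deriv G z = deriv g z / g z" if z_in: "z \<in> S" for z
  proof -
    have "(G has_field_derivative deriv G z) (at z)"
      using hol_G domain(1) z_in by (rule holomorphic_derivI)
    then have "((\<lambda>w. exp (G w)) has_field_derivative g z * deriv G z) (at z)"
      using exp_G[OF z_in] by (auto intro!: derivative_eq_intros)
    then have "(g has_field_derivative g z * deriv G z) (at z)"
      by (rule has_field_derivative_transform_within_open[OF _ domain(1) z_in exp_G])
    then show ?thesis using nz[OF z_in] by (simp add: DERIV_imp_deriv)
  qed
  with hol_G exp_G show thesis by (rule that)
qed (use that[of g] hol in auto)

lemma norm_logderiv_le_if_zero_free:
  assumes hol: "g holomorphic_on ball p R" and nz: "\<And>w. w \<in> ball p R \<Longrightarrow> g w \<noteq> 0"
    and norm_le: "\<And>w. w \<in> ball p R \<Longrightarrow> norm (g w) \<le> norm (g p) * exp A" and z_in: "z \<in> ball p R"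
  shows "norm (deriv g z / g z) \<le> 8 * A * R / (R - dist p z)\<^sup>2"
proof -
  obtain G where hol_G: "G holomorphic_on ball p R" and exp_G: "\<And>w. w \<in> ball p R \<Longrightarrow> exp (G w) = g w"
    and deriv_G: "\<And>w. w \<in> ball p R \<Longrightarrow> deriv G w = deriv g w / g w"
    using exists_holomorphic_log[OF hol open_ball convex_ball nz] by blast
  have "R > 0" using z_in zero_le_dist[of p z] unfolding mem_ball by linarith
  then have p_in_ball: "p \<in> ball p R" by simp
  have "Re (G w) \<le> Re (G p) + A" if "w \<in> ball p R" for w
  proof -
    have "exp (Re (G w)) \<le> exp (Re (G p) + A)"
      using norm_le[OF that] exp_G[OF that] exp_G[OF p_in_ball] by (metis exp_add norm_exp_eq_Re)
    then show ?thesis by simp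
  qed
  then show ?thesis using norm_deriv_le_if_Re_le[OF hol_G _ z_in] deriv_G[OF z_in] by fastforce
qed

lemma le_twice_if_two_power_le_exp:
  assumes "2 ^ n \<le> exp A"
  shows "real n \<le> 2 * A"
proof -
  have "n * ln 2 \<le> A"
    using assms ln_mono[of "2 ^ n" "exp A"] by (simp add: ln_realpow)
  moreover have "n * (1 / 2) \<le> n * ln (2::real)"
    using ln2_ge_two_thirds by (intro mult_left_mono) auto
  ultimately show ?thesis by linarith
qed

lemma norm_logderiv_le:
  fixes f :: "complex \<Rightarrow> complex" and A r :: real
  assumes hol: "f holomorphic_on S" and "open S" and subset: "cball p (3 * r) \<subseteq> S"
    and r_pos: "r > 0" and "f p \<noteq> 0"
    and sphere_le: "\<And>z. z \<in> sphere p (3 * r) \<Longrightarrow> norm (f z) \<le> norm (f p) * exp A"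
  obtains Z where "size Z \<le> 2 * A"
    "\<And>z d. z \<in> cball p (r / 2) \<Longrightarrow> d > 0 \<Longrightarrow> (\<And>a. a \<in># Z \<Longrightarrow> d \<le> dist a z) \<Longrightarrow>
       f z \<noteq> 0 \<and> norm (deriv f z / f z) \<le> size Z / d + 32 * A / r"
proof -
  obtain Z g where fac: "zero_factorization S f Z g" and zeros: "set_mset Z \<subseteq> cball p r"
    and nz: "\<And>z. z \<in> cball p r \<Longrightarrow> g z \<noteq> 0"
    using exists_zero_factorization_zero_free[OF hol \<open>open S\<close> subset r_pos \<open>f p \<noteq> 0\<close>] by blast
  have "2 ^ size Z * norm (f p) \<le> norm (f p) * exp A"
    using two_power_size_zeros_le[OF fac zeros r_pos subset sphere_le] .
  then have "2 ^ size Z \<le> exp A" using \<open>f p \<noteq> 0\<close> by simp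
  then have "size Z \<le> 2 * A" by (rule le_twice_if_two_power_le_exp)
  moreover have "f z \<noteq> 0 \<and> norm (deriv f z / f z) \<le> size Z / d + 32 * A / r"
    if z_in_half: "z \<in> cball p (r / 2)" and d_le_dist: "d > 0" "\<And>a. a \<in># Z \<Longrightarrow> d \<le> dist a z" for z d
  proof -
    have z_in: "z \<in> ball p r" using z_in_half r_pos by auto
    then have "z \<in> S" "g z \<noteq> 0" using nz[of z] subset r_pos by auto
    moreover have "z \<notin># Z" using d_le_dist(1) d_le_dist(2)[of z] by auto
    ultimately have logderiv: "f z \<noteq> 0"
      "deriv f z / f z = (\<Sum>a\<in>#Z. 1 / (z - a)) + deriv g z / g z"
      using logderiv_zero_factorization[OF fac \<open>open S\<close>] by blast+
    have "norm (\<Sum>a\<in>#Z. 1 / (z - a)) \<le> size Z * (1 / d)"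
      using d_le_dist by (intro norm_sum_mset_le)
        (auto simp: norm_divide dist_norm norm_minus_commute intro: frac_le)
    moreover have "norm (deriv g z / g z) \<le> 8 * A * r / (r - dist p z)\<^sup>2"
    proof (rule norm_logderiv_le_if_zero_free)
      have "ball p r \<subseteq> S" using subset r_pos by auto
      then show "g holomorphic_on ball p r"
        using fac holomorphic_on_subset by (auto simp: zero_factorization_def)
      show "norm (g w) \<le> norm (g p) * exp A" if "w \<in> ball p r" for w
        using norm_cofactor_le_center[OF fac zeros r_pos subset sphere_le, of w] that r_pos
          \<open>f p \<noteq> 0\<close>
        by (simp add: mult.commute)
    qed (use nz z_in in auto)
    moreover have "8 * A * r / (r - dist p z)\<^sup>2 \<le> 8 * A * r / (r / 2)\<^sup>2"
      using z_in_half r_pos \<open>size Z \<le> 2 * A\<close> by (intro divide_left_mono power_mono) auto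
    moreover have "8 * A * r / (r / 2)\<^sup>2 = 32 * A / r"
      using r_pos by (simp add: field_simps power2_eq_square)
    ultimately have "norm (deriv f z / f z) \<le> size Z / d + 32 * A / r"
      unfolding logderiv(2) by (intro norm_triangle_le) simp
    with logderiv(1) show ?thesis by simp
  qed
  ultimately show thesis by (rule that)
qed

lemma exists_radius_avoiding:
  fixes X :: "real set"
  assumes "finite X" and \<delta>_pos: "\<delta> > 0"
  obtains s where "0 < s" "s \<le> \<delta>" "\<And>x. x \<in> X \<Longrightarrow> \<delta> / (2 * (card X + 1)) \<le> \<bar>x - s\<bar>"
proof -
  define \<eta> where "\<eta> = \<delta> / (2 * (real (card X) + 1))"
  have \<eta>_props: "\<eta> > 0" "\<delta> = \<eta> * (2 * (real (card X) + 1))" using \<delta>_pos by (auto simp: \<eta>_def)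
  define s where "s j = \<eta> * (2 * real j + 1)" for j :: nat
  have s_bounds: "0 < s j" "s j \<le> \<delta>" if "j \<le> card X" for j
    using \<eta>_props(1) that unfolding s_def by (auto simp: \<eta>_props(2))
  have "\<exists>j\<le>card X. \<forall>x\<in>X. \<eta> \<le> \<bar>x - s j\<bar>"
  proof (rule ccontr)
    assume "\<not> ?thesis"
    then obtain x where x_near_s: "\<And>j. j \<le> card X \<Longrightarrow> x j \<in> X \<and> \<bar>x j - s j\<bar> < \<eta>"
      by (metis not_le)
    have "inj_on x {..card X}"
    proof (rule inj_onI)
      fix i j assume same_value: "i \<in> {..card X}" "j \<in> {..card X}" "x i = x j"
      then have "\<bar>s i - s j\<bar> < 2 * \<eta>" using x_near_s[of i] x_near_s[of j] by auto
      moreover have "s i - s j = 2 * \<eta> * (real i - real j)"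
        by (simp add: s_def algebra_simps)
      ultimately have "\<bar>real i - real j\<bar> < 1" using \<eta>_props(1) by (simp add: abs_mult)
      then show "i = j" by linarith
    qed
    then have "card {..card X} \<le> card X"
      using x_near_s \<open>finite X\<close> by (intro card_inj_on_le) auto
    then show False by simp
  qed
  then obtain j where "j \<le> card X" "\<And>x. x \<in> X \<Longrightarrow> \<eta> \<le> \<bar>x - s j\<bar>" by blast
  with s_bounds show thesis by (intro that[of "s j"]) (auto simp: \<eta>_def add.commute)
qed

lemma exists_annulus_avoiding:
  fixes Z :: "'a::metric_space multiset" and \<delta> d :: real
  assumes \<delta>_pos: "\<delta> > 0" and d_le: "d \<le> \<delta> / (4 * (size Z + 1))"
  obtains s where "0 < s" "s \<le> \<delta>" "\<And>a w. a \<in># Z \<Longrightarrow> \<bar>dist p w - s\<bar> \<le> d \<Longrightarrow> d \<le> dist a w"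
proof -
  define X where "X = dist p ` set_mset Z"
  have "card X \<le> card (set_mset Z)" unfolding X_def by (rule card_image_le) simp
  also have "\<dots> \<le> size Z"
    using size_mset_mono[OF mset_set_set_mset_msubset[of Z]] by simp
  finally have "\<delta> / (2 * (size Z + 1)) \<le> \<delta> / (2 * (card X + 1))"
    using \<delta>_pos by (intro divide_left_mono) auto
  moreover have "2 * d \<le> \<delta> / (2 * (size Z + 1))" using d_le by (simp add: field_simps)
  ultimately have two_d_le: "2 * d \<le> \<delta> / (2 * (card X + 1))" by linarith
  obtain s where s_bounds: "0 < s" "s \<le> \<delta>"
    and avoid: "\<And>x. x \<in> X \<Longrightarrow> \<delta> / (2 * (card X + 1)) \<le> \<bar>x - s\<bar>"
    using exists_radius_avoiding[OF _ \<delta>_pos, of X] by (auto simp: X_def)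
  have "d \<le> dist a w" if "a \<in># Z" "\<bar>dist p w - s\<bar> \<le> d" for a w
  proof -
    have "2 * d \<le> \<bar>dist p a - s\<bar>" using two_d_le avoid[of "dist p a"] that(1) by (simp add: X_def)
    then show ?thesis
      using that(2) dist_triangle[of p a w] dist_triangle[of p w a] by (simp add: dist_commute)
  qed
  with s_bounds show thesis by (rule that)
qed

definition logderivs_le :: "(complex \<Rightarrow> complex) \<Rightarrow> real \<Rightarrow> complex \<Rightarrow> bool" where
  "logderivs_le f U z \<longleftrightarrow>
     f z \<noteq> 0 \<and> norm (deriv f z / f z) \<le> U \<and> norm (deriv (deriv f) z / f z) \<le> U"

lemma norm_deriv2_quotient_le:
  assumes hol: "f holomorphic_on S" and "open S" and subset: "cball z d \<subseteq> S" and d_pos: "d > 0"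
    and logderiv_le: "\<And>w. w \<in> cball z d \<Longrightarrow> f w \<noteq> 0 \<and> norm (deriv f w / f w) \<le> U"
  shows "norm (deriv (deriv f) z / f z) \<le> U / d + U\<^sup>2"
proof -
  define v where "v w = deriv f w / f w" for w
  have hol_deriv: "deriv f holomorphic_on S" using hol \<open>open S\<close> by (rule holomorphic_deriv)
  have z_props: "z \<in> S" "f z \<noteq> 0" "norm (v z) \<le> U"
    using logderiv_le[of z] d_pos subset by (auto simp: v_def)
  have hol_v: "v holomorphic_on cball z d"
    unfolding v_def using logderiv_le subset
    by (intro holomorphic_on_divide holomorphic_on_subset[OF hol]
        holomorphic_on_subset[OF hol_deriv]) auto
  have "norm ((deriv ^^ 1) v z) \<le> fact 1 * U / d ^ 1"
  proof (rule Cauchy_inequality)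
    show "v holomorphic_on ball z d" using hol_v ball_subset_cball by (rule holomorphic_on_subset)
    show "continuous_on (cball z d) v" using hol_v by (rule holomorphic_on_imp_continuous_on)
    show "norm (v w) \<le> U" if "norm (z - w) = d" for w
      using logderiv_le[of w] that by (simp add: v_def dist_norm)
  qed (rule d_pos)
  then have deriv_v_le: "norm (deriv v z) \<le> U / d" by simp
  have "(v has_field_derivative
      (deriv (deriv f) z * f z - deriv f z * deriv f z) / (f z * f z)) (at z)"
    unfolding v_def using z_props \<open>open S\<close>
    by (intro DERIV_divide holomorphic_derivI[OF hol] holomorphic_derivI[OF hol_deriv]) auto
  then have "deriv v z = (deriv (deriv f) z * f z - deriv f z * deriv f z) / (f z * f z)"
    by (rule DERIV_imp_deriv)
  then have "deriv (deriv f) z / f z = deriv v z + (v z)\<^sup>2"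
    using z_props by (simp add: v_def field_simps power2_eq_square)
  also have "norm \<dots> \<le> norm (deriv v z) + (norm (v z))\<^sup>2"
    by (metis norm_power norm_triangle_ineq)
  also have "\<dots> \<le> U / d + U\<^sup>2"
    using deriv_v_le z_props by (intro add_mono power_mono) auto
  finally show ?thesis .
qed

lemma exists_annulus_logderiv_le:
  fixes f :: "complex \<Rightarrow> complex" and A r \<delta> :: real
  assumes hol: "f holomorphic_on S" and "open S" and subset: "cball p (3 * r) \<subseteq> S"
    and r_ge_1: "r \<ge> 1" and "f p \<noteq> 0"
    and sphere_le: "\<And>z. z \<in> sphere p (3 * r) \<Longrightarrow> norm (f z) \<le> norm (f p) * exp A"
    and \<delta>_bounds: "0 < \<delta>" "\<delta> \<le> 1" and z0_inside: "cball z0 (2 * \<delta>) \<subseteq> cball p (r / 2)"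
  obtains s where "A \<ge> 0" "0 < s" "s \<le> \<delta>"
    "\<And>w. \<bar>dist z0 w - s\<bar> \<le> \<delta> / (4 * (2 * A + 1)) \<Longrightarrow>
       f w \<noteq> 0 \<and> norm (deriv f w / f w) \<le> 20 * ((2 * A + 1) / \<delta>)\<^sup>2"
proof -
  obtain Z where size_le: "size Z \<le> 2 * A"
    and logderiv: "\<And>z d. z \<in> cball p (r / 2) \<Longrightarrow> d > 0 \<Longrightarrow> (\<And>a. a \<in># Z \<Longrightarrow> d \<le> dist a z) \<Longrightarrow>
       f z \<noteq> 0 \<and> norm (deriv f z / f z) \<le> size Z / d + 32 * A / r"
    using norm_logderiv_le[OF hol \<open>open S\<close> subset _ \<open>f p \<noteq> 0\<close> sphere_le] r_ge_1 by auto
  have A_nonneg: "A \<ge> 0" using size_le by linarith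
  define d where "d = \<delta> / (4 * (2 * A + 1))"
  define x where "x = (2 * A + 1) / \<delta>"
  have d_bounds: "0 < d" "d \<le> \<delta>"
    using A_nonneg \<delta>_bounds by (auto simp: d_def divide_le_eq mult_le_cancel_left1)
  have "(2 * A + 1) / 1 \<le> x"
    unfolding x_def using A_nonneg \<delta>_bounds by (intro divide_left_mono) auto
  then have x_bounds: "2 * A \<le> x" "1 \<le> x" using A_nonneg by auto
  have quotient_le: "size Z / d + 32 * A / r \<le> 20 * x\<^sup>2"
  proof -
    have "size Z / d = size Z * (4 * x)" using A_nonneg \<delta>_bounds by (simp add: d_def x_def)
    also have "\<dots> \<le> x * (4 * x)" using size_le x_bounds by (intro mult_right_mono) auto
    finally have "size Z / d \<le> 4 * x\<^sup>2" by (simp add: power2_eq_square)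
    moreover have "32 * A / r \<le> 32 * A / 1" using A_nonneg r_ge_1 by (intro divide_left_mono) auto
    moreover have "x \<le> x\<^sup>2" using x_bounds(2) by (simp add: power2_eq_square)
    ultimately show ?thesis using x_bounds(1) by linarith
  qed
  have "d \<le> \<delta> / (4 * (size Z + 1))"
    unfolding d_def using A_nonneg \<delta>_bounds size_le by (intro divide_left_mono) auto
  then obtain s where s_bounds: "0 < s" "s \<le> \<delta>"
    and avoid: "\<And>a w. a \<in># Z \<Longrightarrow> \<bar>dist z0 w - s\<bar> \<le> d \<Longrightarrow> d \<le> dist a w"
    using exists_annulus_avoiding[OF \<delta>_bounds(1)] by blast
  have "f w \<noteq> 0 \<and> norm (deriv f w / f w) \<le> 20 * x\<^sup>2" if w_in_annulus: "\<bar>dist z0 w - s\<bar> \<le> d" for w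
  proof -
    have "w \<in> cball z0 (2 * \<delta>)" using w_in_annulus s_bounds(2) d_bounds(2) by simp
    then have "w \<in> cball p (r / 2)" using z0_inside by blast
    with logderiv[OF _ d_bounds(1) avoid[OF _ w_in_annulus]] quotient_le show ?thesis by auto
  qed
  with A_nonneg s_bounds show thesis by (intro that) (simp_all add: d_def x_def)
qed

lemma exists_circle_logderivs_le:
  fixes f :: "complex \<Rightarrow> complex" and A r \<delta> :: real
  assumes hol: "f holomorphic_on S" and "open S" and subset: "cball p (3 * r) \<subseteq> S"
    and r_ge_1: "r \<ge> 1" and "f p \<noteq> 0"
    and sphere_le: "\<And>z. z \<in> sphere p (3 * r) \<Longrightarrow> norm (f z) \<le> norm (f p) * exp A"
    and \<delta>_bounds: "0 < \<delta>" "\<delta> \<le> 1" and z0_inside: "cball z0 (2 * \<delta>) \<subseteq> cball p (r / 2)"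
  obtains s where "0 < s" "s \<le> \<delta>"
    "\<And>z. z \<in> sphere z0 s \<Longrightarrow> logderivs_le f (500 * ((2 * A + 1) / \<delta>) ^ 4) z"
proof -
  define d where "d = \<delta> / (4 * (2 * A + 1))"
  define x where "x = (2 * A + 1) / \<delta>"
  obtain s where "A \<ge> 0" and s_bounds: "0 < s" "s \<le> \<delta>"
    and annulus: "\<And>w. \<bar>dist z0 w - s\<bar> \<le> d \<Longrightarrow> f w \<noteq> 0 \<and> norm (deriv f w / f w) \<le> 20 * x\<^sup>2"
    using exists_annulus_logderiv_le[OF hol \<open>open S\<close> subset r_ge_1 \<open>f p \<noteq> 0\<close> sphere_le
        \<delta>_bounds z0_inside]
    unfolding d_def x_def by blast
  have x_bounds: "x \<ge> 1" "1 / d = 4 * x"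
    using \<open>A \<ge> 0\<close> \<delta>_bounds by (auto simp: x_def d_def field_simps)
  have d_bounds: "0 < d" "d \<le> \<delta>"
    using \<open>A \<ge> 0\<close> \<delta>_bounds by (auto simp: d_def divide_le_eq mult_le_cancel_left1)
  have x_powers: "x\<^sup>2 \<le> x ^ 4" "x ^ 3 \<le> x ^ 4" "1 \<le> x ^ 4"
    using x_bounds(1) by (auto intro: power_increasing)
  have "logderivs_le f (500 * x ^ 4) z" if z_on_circle: "z \<in> sphere z0 s" for z
  proof -
    have near: "\<bar>dist z0 w - s\<bar> \<le> d" if "w \<in> cball z d" for w
      using z_on_circle that dist_triangle[of z0 w z] dist_triangle[of z0 z w]
      by (simp add: dist_commute)
    then have "cball z d \<subseteq> cball z0 (2 * \<delta>)" using s_bounds(2) d_bounds(2) by fastforce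
    also note z0_inside
    also have "cball p (r / 2) \<subseteq> cball p (3 * r)" using r_ge_1 by (intro subset_cball) simp
    also note subset
    finally have "norm (deriv (deriv f) z / f z) \<le> 20 * x\<^sup>2 / d + (20 * x\<^sup>2)\<^sup>2"
      using annulus near d_bounds(1) by (intro norm_deriv2_quotient_le[OF hol \<open>open S\<close>]) auto
    also have "20 * x\<^sup>2 / d = 20 * x\<^sup>2 * (1 / d)" by simp
    also have "\<dots> + (20 * x\<^sup>2)\<^sup>2 = 80 * x ^ 3 + 400 * x ^ 4"
      unfolding x_bounds(2) by (simp add: power_mult_distrib eval_nat_numeral)
    finally have "norm (deriv (deriv f) z / f z) \<le> 500 * x ^ 4" using x_powers by linarith
    moreover have "f z \<noteq> 0 \<and> norm (deriv f z / f z) \<le> 20 * x\<^sup>2"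
      using z_on_circle d_bounds(1) by (intro annulus) simp
    moreover have "20 * x\<^sup>2 \<le> 500 * x ^ 4" using x_powers by linarith
    ultimately show ?thesis unfolding logderivs_le_def by linarith
  qed
  with s_bounds show thesis unfolding x_def by (rule that)
qed

lemma eventually_norm_sphere_le_exp_power:
  fixes f :: "complex \<Rightarrow> complex" and c :: real
  assumes cont: "continuous_on UNIV f" and finite_order: "entire_order f \<noteq> \<infinity>"
    and "f p \<noteq> 0" and c_pos: "c > 0"
  obtains k :: nat
    where "\<forall>\<^sub>F t in at_top. \<forall>z\<in>sphere p (c * t). norm (f z) \<le> norm (f p) * exp (t ^ k)"
proof -
  obtain K :: nat where "\<forall>\<^sub>F z in at_infinity. norm (f z) \<le> exp (norm z ^ K)"
    using eventually_norm_le_exp_power_if_entire_order_finite[OF cont finite_order] by blast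
  then obtain R where growth_beyond_R: "\<And>z. norm z \<ge> R \<Longrightarrow> norm (f z) \<le> exp (norm z ^ K)"
    unfolding eventually_at_infinity by blast
  have "\<forall>\<^sub>F t in at_top. ((c + 1) * t) ^ K \<le> ln (norm (f p)) + t ^ Suc K"
    using c_pos by real_asymp
  moreover have "\<forall>\<^sub>F t in at_top. R + norm p \<le> c * t"
    using c_pos by real_asymp
  ultimately have "\<forall>\<^sub>F t in at_top. \<forall>z\<in>sphere p (c * t). norm (f z) \<le> norm (f p) * exp (t ^ Suc K)"
    using eventually_ge_at_top[of "norm p"]
  proof (eventually_elim, intro ballI)
    fix t z
    assume t_large: "((c + 1) * t) ^ K \<le> ln (norm (f p)) + t ^ Suc K"
        "R + norm p \<le> c * t" "norm p \<le> t"
      and "z \<in> sphere p (c * t)"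
    then have "dist p z = c * t" by simp
    then have z_bounds: "norm z \<ge> R" "norm z \<le> (c + 1) * t"
      using t_large norm_triangle_ineq2[of z p] norm_triangle_ineq4[of z p]
      by (auto simp: dist_norm norm_minus_commute distrib_right)
    have "norm (f z) \<le> exp (norm z ^ K)" using z_bounds(1) by (rule growth_beyond_R)
    also have "\<dots> \<le> exp (((c + 1) * t) ^ K)"
      using power_mono[OF z_bounds(2) norm_ge_zero, of K] by simp
    also have "\<dots> \<le> exp (ln (norm (f p)) + t ^ Suc K)" using t_large(1) by simp
    also have "\<dots> = norm (f p) * exp (t ^ Suc K)" using \<open>f p \<noteq> 0\<close> by (simp add: exp_add)
    finally show "norm (f z) \<le> norm (f p) * exp (t ^ Suc K)" .
  qed
  then show thesis by (rule that)
qed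

lemma circle_bound_le_power:
  fixes t :: real
  assumes t_ge_500: "t \<ge> 500"
  shows "500 * ((2 * t ^ k + 1) * t ^ m) ^ 4 \<le> t ^ Suc ((k + m + 1) * 4)"
proof -
  have "2 * t ^ k + 1 \<le> 3 * t ^ k" using t_ge_500 by simp
  also have "\<dots> \<le> t * t ^ k" using t_ge_500 by (intro mult_right_mono) auto
  finally have "(2 * t ^ k + 1) * t ^ m \<le> t * t ^ k * t ^ m"
    using t_ge_500 by (intro mult_right_mono) auto
  then have "(2 * t ^ k + 1) * t ^ m \<le> t ^ (k + m + 1)" by (simp add: power_add mult_ac)
  then have "500 * ((2 * t ^ k + 1) * t ^ m) ^ 4 \<le> t * (t ^ (k + m + 1)) ^ 4"
    using t_ge_500 by (intro mult_mono power_mono) auto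
  also have "\<dots> = t ^ Suc ((k + m + 1) * 4)" by (simp only: power_Suc power_mult)
  finally show ?thesis .
qed

lemma eventually_exists_circle_logderivs_le_power:
  assumes hol: "f holomorphic_on UNIV" and "f p \<noteq> 0" and finite_order: "entire_order f \<noteq> \<infinity>"
  obtains L :: nat where "\<forall>\<^sub>F z0 in at_infinity.
    \<exists>s>0. s * norm z0 ^ m \<le> 1 \<and> (\<forall>z\<in>sphere z0 s. logderivs_le f (norm z0 ^ L) z)"
proof -
  have "continuous_on UNIV f" using hol by (rule holomorphic_on_imp_continuous_on)
  then obtain k :: nat
    where "\<forall>\<^sub>F t in at_top. \<forall>z\<in>sphere p (12 * t). norm (f z) \<le> norm (f p) * exp (t ^ k)"
    using eventually_norm_sphere_le_exp_power[OF _ finite_order \<open>f p \<noteq> 0\<close>] zero_less_numeral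
    by blast
  then have "\<forall>\<^sub>F z0::complex in at_infinity.
      \<forall>z\<in>sphere p (12 * norm z0). norm (f z) \<le> norm (f p) * exp (norm z0 ^ k)"
    by (rule eventually_compose_filterlim[OF _ filterlim_norm_at_top])
  moreover have "\<forall>\<^sub>F z0::complex in at_infinity. norm z0 \<ge> max 500 (norm p + 2)"
    unfolding eventually_at_infinity by blast
  ultimately have "\<forall>\<^sub>F z0 in at_infinity. \<exists>s>0. s * norm z0 ^ m \<le> 1 \<and>
      (\<forall>z\<in>sphere z0 s. logderivs_le f (norm z0 ^ Suc ((k + m + 1) * 4)) z)"
  proof eventually_elim
    case (elim z0)
    define t where "t = norm z0"
    have t_large: "t \<ge> 500" "t \<ge> norm p + 2" using elim by (auto simp: t_def)
    have growth: "norm (f z) \<le> norm (f p) * exp (t ^ k)" if "z \<in> sphere p (3 * (4 * t))" for z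
      using elim(1) that by (simp add: t_def)
    define \<delta> where "\<delta> = 1 / t ^ m"
    have \<delta>_bounds: "0 < \<delta>" "\<delta> \<le> 1" using t_large by (auto simp: \<delta>_def)
    have subset: "cball z0 (2 * \<delta>) \<subseteq> cball p (4 * t / 2)"
    proof
      fix w assume "w \<in> cball z0 (2 * \<delta>)"
      then show "w \<in> cball p (4 * t / 2)"
        using \<delta>_bounds(2) t_large(2) dist_triangle[of p w z0] norm_triangle_ineq4[of p z0]
        by (simp add: dist_norm t_def)
    qed
    obtain s where s_bounds: "0 < s" "s \<le> \<delta>"
      and circle: "\<And>z. z \<in> sphere z0 s \<Longrightarrow> logderivs_le f (500 * ((2 * t ^ k + 1) / \<delta>) ^ 4) z"
      using exists_circle_logderivs_le[OF hol open_UNIV _ _ \<open>f p \<noteq> 0\<close> growth \<delta>_bounds subset]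
        t_large by auto
    have "500 * ((2 * t ^ k + 1) / \<delta>) ^ 4 \<le> t ^ Suc ((k + m + 1) * 4)"
      using circle_bound_le_power[OF t_large(1), of k m] by (simp add: \<delta>_def)
    then have "logderivs_le f (t ^ Suc ((k + m + 1) * 4)) z" if "z \<in> sphere z0 s" for z
      using circle[OF that] by (auto simp: logderivs_le_def)
    moreover have "s * t ^ m \<le> 1" using s_bounds(2) t_large by (simp add: \<delta>_def pos_le_divide_eq)
    ultimately show ?case using s_bounds(1) unfolding t_def by blast
  qed
  then show thesis by (rule that)
qed

subsection \<open>Growth of polynomials\<close>

lemma poly_bigtheta_power_degree:
  fixes p :: "'a::real_normed_field poly"
  assumes "p \<noteq> 0"
  shows "poly p \<in> \<Theta>[at_infinity](\<lambda>z. z ^ degree p)"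
proof (rule bigthetaI_tendsto_norm)
  show "norm (lead_coeff p) \<noteq> 0" using assms by simp
qed (intro tendsto_norm poly_divide_tendsto_aux)

lemma eventually_at_infinity_cball:
  fixes P :: "'a::real_normed_vector \<Rightarrow> bool"
  assumes "\<forall>\<^sub>F z in at_infinity. P z"
  shows "\<forall>\<^sub>F w in at_infinity. \<forall>z\<in>cball w r. P z"
proof -
  obtain R where beyond_R: "\<And>z. norm z \<ge> R \<Longrightarrow> P z"
    using assms unfolding eventually_at_infinity by blast
  have "P z" if "norm w \<ge> R + r" "z \<in> cball w r" for w z
    using that norm_triangle_ineq2[of w z] by (intro beyond_R) (auto simp: dist_norm)
  then show ?thesis unfolding eventually_at_infinity by blast
qed

lemma eventually_norm_poly_diff_le:
  fixes p :: "'a::{real_normed_field,field_char_0} poly"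
  shows "\<forall>\<^sub>F w in at_infinity. \<forall>z. norm (z - w) \<le> 1 \<longrightarrow>
    norm (poly p z - poly p w) \<le> norm w ^ degree p * norm (z - w)"
proof (cases "degree p = 0")
  case True
  then obtain a where "p = [:a:]" by (rule degree_eq_zeroE)
  then show ?thesis by simp
next
  case False
  define k where "k = degree p - 1"
  have degree: "degree p = Suc k" "degree (pderiv p) = k"
    using False by (auto simp: k_def degree_pderiv)
  have "pderiv p \<noteq> 0" using False by (simp add: pderiv_eq_0_iff)
  from poly_bigtheta_power_degree[OF this] have "poly (pderiv p) \<in> O[at_infinity](\<lambda>z. z ^ k)"
    by (auto simp: degree)
  then obtain C where C_pos: "C > 0"
    and "\<forall>\<^sub>F u in at_infinity. norm (poly (pderiv p) u) \<le> C * norm (u ^ k)"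
    by (rule landau_o.bigE)
  then have "\<forall>\<^sub>F w in at_infinity. \<forall>u\<in>cball w 1. norm (poly (pderiv p) u) \<le> C * norm (u ^ k)"
    by (intro eventually_at_infinity_cball)
  moreover have "\<forall>\<^sub>F w::'a in at_infinity. norm w \<ge> max 1 (C * 2 ^ k)"
    unfolding eventually_at_infinity by blast
  ultimately show ?thesis
  proof (eventually_elim, intro allI impI)
    fix w z :: 'a
    assume deriv_le: "\<forall>u\<in>cball w 1. norm (poly (pderiv p) u) \<le> C * norm (u ^ k)"
      and w_large: "norm w \<ge> max 1 (C * 2 ^ k)" and z_near: "norm (z - w) \<le> 1"
    show "norm (poly p z - poly p w) \<le> norm w ^ degree p * norm (z - w)"
    proof (rule field_differentiable_bound[of "cball w 1" "poly p" "poly (pderiv p)"])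
      fix u assume u_near: "u \<in> cball w 1"
      then have "norm u \<le> 2 * norm w"
        using w_large norm_triangle_ineq2[of u w] by (auto simp: dist_norm norm_minus_commute)
      have "norm (poly (pderiv p) u) \<le> C * norm u ^ k"
        using deriv_le u_near by (simp add: norm_power)
      also have "\<dots> \<le> C * (2 * norm w) ^ k"
        using C_pos \<open>norm u \<le> 2 * norm w\<close> by (intro mult_left_mono power_mono) auto
      also have "\<dots> = C * 2 ^ k * norm w ^ k" by (simp add: power_mult_distrib)
      also have "\<dots> \<le> norm w * norm w ^ k" using w_large by (intro mult_right_mono) auto
      finally show "norm (poly (pderiv p) u) \<le> norm w ^ degree p" by (simp add: degree)
    qed (use z_near in \<open>auto simp: dist_norm norm_minus_commute
            intro!: has_field_derivative_at_within poly_DERIV\<close>)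
  qed
qed

lemma norm_poly_powr_bigtheta:
  fixes p :: "'a::real_normed_field poly" and s :: real
  assumes "degree p > 0"
  shows "(\<lambda>z. norm (poly p z) powr (s / degree p)) \<in> \<Theta>[at_infinity](\<lambda>z. norm z powr s)"
proof -
  have "p \<noteq> 0" using assms by auto
  then have "(\<lambda>z. norm (poly p z)) \<in> \<Theta>[at_infinity](\<lambda>z. norm (z ^ degree p))"
    by (simp add: poly_bigtheta_power_degree)
  then have "(\<lambda>z. \<bar>norm (poly p z)\<bar> powr (s / degree p))
      \<in> \<Theta>[at_infinity](\<lambda>z. \<bar>norm (z ^ degree p)\<bar> powr (s / degree p))"
    by (rule bigtheta_powr)
  also have "\<forall>\<^sub>F z::'a in at_infinity. \<bar>norm (z ^ degree p)\<bar> powr (s / degree p) = norm z powr s"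
    using eventually_not_equal_at_infinity[of 0]
    by eventually_elim (use assms in \<open>simp add: norm_power powr_powr flip: powr_realpow\<close>)
  finally show ?thesis by simp
qed

subsection \<open>A Phragmen-Lindelof principle\<close>

lemma Re_powr_of_real_ge:
  assumes "Re w \<ge> 0" and \<tau>_bounds: "0 \<le> \<tau>" "\<tau> \<le> 1"
  shows "cos (\<tau> * pi / 2) * norm w powr \<tau> \<le> Re (w powr complex_of_real \<tau>)"
proof (cases "w = 0")
  case False
  then have arg_le: "\<bar>Im (Ln w)\<bar> \<le> pi / 2" using Re_Ln_pos_le assms(1) by blast
  have "cos (\<tau> * pi / 2) \<le> cos (\<tau> * \<bar>Im (Ln w)\<bar>)"
  proof (rule cos_monotone_0_pi_le)
    show "\<tau> * \<bar>Im (Ln w)\<bar> \<le> \<tau> * pi / 2"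
      using mult_left_mono[OF arg_le \<tau>_bounds(1)] by simp
    show "\<tau> * pi / 2 \<le> pi"
      using mult_right_mono[OF \<tau>_bounds(2), of pi] pi_gt_zero by linarith
  qed (use \<tau>_bounds in auto)
  also have "\<dots> = cos (\<tau> * Im (Ln w))"
    using \<tau>_bounds by (metis abs_mult abs_of_nonneg cos_abs_real)
  finally have "cos (\<tau> * pi / 2) * norm w powr \<tau> \<le> cos (\<tau> * Im (Ln w)) * norm w powr \<tau>"
    by (intro mult_right_mono) auto
  also have "\<dots> = Re (w powr complex_of_real \<tau>)"
    using False by (simp add: powr_def Re_exp)
  finally show ?thesis .
qed simp

lemma Re_powr_of_real_nonneg:
  assumes "Re w \<ge> 0" "0 \<le> \<tau>" "\<tau> \<le> 1"
  shows "0 \<le> Re (w powr complex_of_real \<tau>)"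
proof -
  have "0 \<le> \<tau> * pi" "\<tau> * pi \<le> 1 * pi" using assms(2,3) by (auto intro: mult_right_mono)
  then have "0 \<le> cos (\<tau> * pi / 2)" using pi_ge_zero by (intro cos_ge_zero; linarith)
  then have "0 \<le> cos (\<tau> * pi / 2) * norm w powr \<tau>" by simp
  also have "\<dots> \<le> Re (w powr complex_of_real \<tau>)" using assms by (rule Re_powr_of_real_ge)
  finally show ?thesis .
qed

lemma maximum_modulus_frontier_unbounded:
  fixes f :: "complex \<Rightarrow> complex"
  assumes "open S" and hol: "f holomorphic_on S" and cont: "continuous_on (closure S) f"
    and frontier: "\<And>z. z \<in> frontier S \<Longrightarrow> norm (f z) \<le> M"
    and infinity: "\<forall>\<^sub>F z in at_infinity. z \<in> S \<longrightarrow> norm (f z) \<le> M"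
    and z_in: "z \<in> S"
  shows "norm (f z) \<le> M"
proof -
  obtain R where bound_beyond_R: "\<And>w. norm w \<ge> R \<Longrightarrow> w \<in> S \<Longrightarrow> norm (f w) \<le> M"
    using infinity unfolding eventually_at_infinity by blast
  define r where "r = max R (norm z + 1)"
  let ?T = "S \<inter> ball 0 r"
  have closure_subset: "closure ?T \<subseteq> closure S \<inter> cball 0 r"
    using closure_subset[of S] by (intro closure_minimal closed_Int) auto
  show ?thesis
  proof (rule maximum_modulus_frontier[of f ?T])
    show "f holomorphic_on interior ?T"
      using interior_subset[of ?T] by (intro holomorphic_on_subset[OF hol]) auto
    show "continuous_on (closure ?T) f"
      using closure_subset by (intro continuous_on_subset[OF cont]) auto
    show "z \<in> ?T" using z_in by (auto simp: r_def)
  next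
    fix w assume "w \<in> frontier ?T"
    then have w_on_frontier: "w \<in> closure S" "w \<in> cball 0 r" "w \<notin> ?T"
      using closure_subset \<open>open S\<close> by (auto simp: frontier_def interior_open open_Int)
    show "norm (f w) \<le> M"
    proof (cases "w \<in> S")
      case True
      with w_on_frontier show ?thesis by (intro bound_beyond_R) (auto simp: r_def)
    next
      case False
      with w_on_frontier \<open>open S\<close> show ?thesis
        by (intro frontier) (auto simp: frontier_def interior_open)
    qed
  qed auto
qed

lemma Phragmen_Lindelof:
  fixes h E \<omega> :: "complex \<Rightarrow> complex"
  assumes "open S"
    and hol: "h holomorphic_on S" "E holomorphic_on S" "\<omega> holomorphic_on S"
    and cont: "continuous_on (closure S) h" "continuous_on (closure S) E"
      "continuous_on (closure S) \<omega>"
    and Re_\<omega>_nonneg: "\<And>z. z \<in> frontier S \<Longrightarrow> Re (\<omega> z) \<ge> 0"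
    and frontier: "\<And>z. z \<in> frontier S \<Longrightarrow> norm (h z) \<le> M * exp (Re (E z))"
    and growth: "\<And>\<epsilon>. \<epsilon> > 0 \<Longrightarrow>
      \<forall>\<^sub>F z in at_infinity. z \<in> S \<longrightarrow> norm (h z) \<le> M * exp (Re (E z) + \<epsilon> * Re (\<omega> z))"
    and z_in: "z \<in> S"
  shows "norm (h z) \<le> M * exp (Re (E z))"
proof -
  have le_plus_\<epsilon>: "norm (h z) \<le> M * exp (Re (E z) + \<epsilon> * Re (\<omega> z))" if \<epsilon>_pos: "\<epsilon> > 0" for \<epsilon>
  proof -
    define f where "f w = h w * exp (- (E w + of_real \<epsilon> * \<omega> w))" for w
    have norm_f_le_iff: "norm (f w) \<le> M \<longleftrightarrow> norm (h w) \<le> M * exp (Re (E w) + \<epsilon> * Re (\<omega> w))" for w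
    proof -
      have "norm (f w) = norm (h w) / exp (Re (E w) + \<epsilon> * Re (\<omega> w))"
        unfolding f_def norm_mult exp_minus norm_inverse norm_exp_eq_Re
        by (simp add: divide_inverse)
      then show ?thesis by (simp add: divide_le_eq)
    qed
    have "norm (f z) \<le> M"
    proof (rule maximum_modulus_frontier_unbounded[of S f])
      show "f holomorphic_on S"
        unfolding f_def by (intro holomorphic_intros hol)
      show "continuous_on (closure S) f"
        unfolding f_def by (intro continuous_intros cont)
      show "\<forall>\<^sub>F w in at_infinity. w \<in> S \<longrightarrow> norm (f w) \<le> M"
        unfolding norm_f_le_iff by (rule growth[OF \<epsilon>_pos])
    next
      fix w assume w_on_frontier: "w \<in> frontier S"
      have "0 \<le> M * exp (Re (E w))" using frontier[OF w_on_frontier] norm_ge_zero order_trans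
        by blast
      then have "M \<ge> 0" by (simp add: zero_le_mult_iff)
      then have "M * exp (Re (E w)) \<le> M * exp (Re (E w) + \<epsilon> * Re (\<omega> w))"
        using \<epsilon>_pos Re_\<omega>_nonneg[OF w_on_frontier] by (simp add: mult_left_mono)
      with frontier[OF w_on_frontier] show "norm (f w) \<le> M" unfolding norm_f_le_iff by linarith
    qed (use \<open>open S\<close> z_in in auto)
    then show ?thesis by (simp only: norm_f_le_iff)
  qed
  have "((\<lambda>\<epsilon>. M * exp (Re (E z) + \<epsilon> * Re (\<omega> z))) \<longlongrightarrow> M * exp (Re (E z) + 0 * Re (\<omega> z))) (at_right 0)"
    by (intro tendsto_intros)
  moreover have "\<forall>\<^sub>F \<epsilon> in at_right 0. norm (h z) \<le> M * exp (Re (E z) + \<epsilon> * Re (\<omega> z))"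
    using eventually_at_right_less[of "0::real"] by eventually_elim (rule le_plus_\<epsilon>)
  ultimately have "norm (h z) \<le> M * exp (Re (E z) + 0 * Re (\<omega> z))"
    by (rule tendsto_lowerbound) simp
  then show ?thesis by simp
qed

lemma
  fixes q :: "'a::topological_space \<Rightarrow> complex"
  assumes cont: "continuous_on UNIV q"
  shows open_Collect_Re_pos: "open {z. 0 < Re (q z)}"
    and closure_Collect_Re_pos: "closure {z. 0 < Re (q z)} \<subseteq> {z. 0 \<le> Re (q z)}"
    and frontier_Collect_Re_pos: "frontier {z. 0 < Re (q z)} \<subseteq> {z. Re (q z) = 0}"
proof -
  show "open": "open {z. 0 < Re (q z)}"
    by (intro open_Collect_less continuous_intros cont)
  have "closed {z. 0 \<le> Re (q z)}"
    by (intro closed_Collect_le continuous_intros cont)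
  then show closure_subset: "closure {z. 0 < Re (q z)} \<subseteq> {z. 0 \<le> Re (q z)}"
    by (intro closure_minimal) auto
  with "open" show "frontier {z. 0 < Re (q z)} \<subseteq> {z. Re (q z) = 0}"
    by (force simp: frontier_def interior_open)
qed

lemma holomorphic_on_powr_Re_pos:
  assumes "q holomorphic_on UNIV"
  shows "(\<lambda>z. q z powr c) holomorphic_on {z. 0 < Re (q z)}"
  by (intro holomorphic_intros holomorphic_on_subset[OF assms])
    (auto simp: complex_nonpos_Reals_iff)

lemma continuous_on_powr_Re_nonneg:
  assumes "continuous_on UNIV q" "0 < Re c"
  shows "continuous_on {z. 0 \<le> Re (q z)} (\<lambda>z. q z powr c)"
  using assms by (intro continuous_intros continuous_on_subset[OF assms(1)]) auto

lemma eventually_norm_powr_le: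
  fixes q :: "'a \<Rightarrow> 'b::real_normed_vector" and \<epsilon> \<tau> \<tau>' :: real
  assumes "filterlim q at_infinity F" "\<epsilon> > 0" "\<tau> < \<tau>'"
  shows "\<forall>\<^sub>F z in F. norm (q z) powr \<tau> \<le> \<epsilon> * norm (q z) powr \<tau>'"
proof -
  have "\<forall>\<^sub>F x in at_top. x powr \<tau> \<le> \<epsilon> * x powr \<tau>'"
    using assms(2,3) by real_asymp
  then show ?thesis
    by (rule eventually_compose_filterlim[OF _ filterlim_at_infinity_imp_norm_at_top[OF assms(1)]])
qed

lemma Phragmen_Lindelof_Re_pos:
  fixes h E q :: "complex \<Rightarrow> complex" and \<tau> :: real
  assumes hol_q: "q holomorphic_on UNIV" "filterlim q at_infinity at_infinity"
    and hol: "h holomorphic_on {z. 0 < Re (q z)}" "E holomorphic_on {z. 0 < Re (q z)}"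
    and cont: "continuous_on {z. 0 \<le> Re (q z)} h" "continuous_on {z. 0 \<le> Re (q z)} E"
    and critical: "\<And>z. Re (q z) = 0 \<Longrightarrow> norm (h z) \<le> M * exp (Re (E z))"
    and M_nonneg: "M \<ge> 0" and \<tau>_less_1: "\<tau> < 1"
    and growth: "\<forall>\<^sub>F z in at_infinity. Re (q z) > 0 \<longrightarrow>
      norm (h z) \<le> M * exp (Re (E z) + norm (q z) powr \<tau>)"
    and Re_nonneg: "Re (q z) \<ge> 0"
  shows "norm (h z) \<le> M * exp (Re (E z))"
proof (cases "Re (q z) = 0")
  case False
  let ?S = "{z. 0 < Re (q z)}"
  obtain \<tau>' where \<tau>'_bounds: "max \<tau> 0 < \<tau>'" "\<tau>' < 1" using dense[of "max \<tau> 0" 1] \<tau>_less_1 by auto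
  define \<omega> where "\<omega> z = q z powr complex_of_real \<tau>'" for z
  define \<kappa> where "\<kappa> = cos (\<tau>' * pi / 2)"
  have \<kappa>_pos: "\<kappa> > 0" unfolding \<kappa>_def using \<tau>'_bounds by (intro cos_gt_zero) auto
  have Re_\<omega>: "\<kappa> * norm (q w) powr \<tau>' \<le> Re (\<omega> w)" if "Re (q w) \<ge> 0" for w
    unfolding \<kappa>_def \<omega>_def using that \<tau>'_bounds by (intro Re_powr_of_real_ge) auto
  have cont_q: "continuous_on UNIV q" using hol_q(1) by (rule holomorphic_on_imp_continuous_on)
  note closure = closure_Collect_Re_pos[OF cont_q] and frontier = frontier_Collect_Re_pos[OF cont_q]
  show ?thesis
  proof (rule Phragmen_Lindelof[of ?S h E \<omega>])
    show "open ?S" by (rule open_Collect_Re_pos[OF cont_q])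
    show "\<omega> holomorphic_on ?S"
      unfolding \<omega>_def by (rule holomorphic_on_powr_Re_pos[OF hol_q(1)])
    have "continuous_on {z. 0 \<le> Re (q z)} \<omega>"
      unfolding \<omega>_def using \<tau>'_bounds by (intro continuous_on_powr_Re_nonneg cont_q) auto
    then show "continuous_on (closure ?S) \<omega>" "continuous_on (closure ?S) h"
      "continuous_on (closure ?S) E"
      using closure cont by (blast intro: continuous_on_subset)+
    show "norm (h w) \<le> M * exp (Re (E w))" if "w \<in> frontier ?S" for w
      using frontier that by (intro critical) auto
    show "Re (\<omega> w) \<ge> 0" if "w \<in> frontier ?S" for w
      unfolding \<omega>_def using frontier that \<tau>'_bounds by (intro Re_powr_of_real_nonneg) auto
  next
    fix \<epsilon> :: real assume \<epsilon>_pos: "\<epsilon> > 0"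
    have "\<forall>\<^sub>F w in at_infinity. norm (q w) powr \<tau> \<le> \<epsilon> * \<kappa> * norm (q w) powr \<tau>'"
      using \<epsilon>_pos \<kappa>_pos \<tau>'_bounds by (intro eventually_norm_powr_le hol_q(2)) auto
    with growth show "\<forall>\<^sub>F w in at_infinity. w \<in> ?S \<longrightarrow> norm (h w) \<le> M * exp (Re (E w) + \<epsilon> * Re (\<omega> w))"
    proof eventually_elim
      case (elim w)
      have "M * exp (Re (E w) + norm (q w) powr \<tau>) \<le> M * exp (Re (E w) + \<epsilon> * Re (\<omega> w))"
        if "0 < Re (q w)"
      proof -
        have "\<epsilon> * (\<kappa> * norm (q w) powr \<tau>') \<le> \<epsilon> * Re (\<omega> w)"
          using Re_\<omega>[of w] \<epsilon>_pos that by (intro mult_left_mono) auto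
        with elim(2) M_nonneg show ?thesis by (intro mult_left_mono) (auto simp: mult.assoc)
      qed
      with elim(1) show ?case by fastforce
    qed
  qed (use Re_nonneg False hol in auto)
qed (rule critical)

lemma Phragmen_Lindelof_exp_powr:
  fixes h q :: "complex \<Rightarrow> complex" and \<tau> \<tau>' C :: real
  assumes hol_h: "h holomorphic_on UNIV"
    and hol_q: "q holomorphic_on UNIV" "filterlim q at_infinity at_infinity"
    and \<tau>_bounds: "0 < \<tau>" "\<tau> < 1" and \<tau>'_less_1: "\<tau>' < 1" and M_ge_1: "M \<ge> 1" and C_nonneg: "C \<ge> 0"
    and growth: "\<forall>\<^sub>F z in at_infinity. norm (h z) \<le> exp (norm (q z) powr \<tau>')"
    and critical: "\<And>z. Re (q z) = 0 \<Longrightarrow>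
      norm (h z) \<le> M * exp (C * cos (\<tau> * pi / 2) * norm (q z) powr \<tau>)"
    and Re_nonneg: "Re (q z) \<ge> 0"
  shows "norm (h z) \<le> M * exp (C * norm (q z) powr \<tau>)"
proof -
  define E where "E z = complex_of_real C * q z powr complex_of_real \<tau>" for z
  have Re_E: "C * cos (\<tau> * pi / 2) * norm (q w) powr \<tau> \<le> Re (E w)" if "Re (q w) \<ge> 0" for w
    using mult_left_mono[OF Re_powr_of_real_ge[OF that, of \<tau>] C_nonneg] \<tau>_bounds
    by (simp add: E_def mult.assoc)
  have cont: "continuous_on UNIV q" "continuous_on UNIV h"
    using hol_q(1) hol_h by (auto intro: holomorphic_on_imp_continuous_on)
  have "norm (h z) \<le> M * exp (Re (E z))"
  proof (rule Phragmen_Lindelof_Re_pos[of q h E])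
    show "h holomorphic_on {z. 0 < Re (q z)}" using hol_h by (rule holomorphic_on_subset) auto
    show "continuous_on {z. 0 \<le> Re (q z)} h" using cont(2) by (rule continuous_on_subset) auto
    show "E holomorphic_on {z. 0 < Re (q z)}"
      unfolding E_def by (intro holomorphic_intros holomorphic_on_powr_Re_pos hol_q(1))
    show "continuous_on {z. 0 \<le> Re (q z)} E"
      unfolding E_def using \<tau>_bounds
      by (intro continuous_intros continuous_on_powr_Re_nonneg cont(1)) auto
    show "norm (h w) \<le> M * exp (Re (E w))" if "Re (q w) = 0" for w
    proof -
      have "M * exp (C * cos (\<tau> * pi / 2) * norm (q w) powr \<tau>) \<le> M * exp (Re (E w))"
        using Re_E[of w] that M_ge_1 by (intro mult_left_mono) auto
      with critical[OF that] show ?thesis by linarith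
    qed
    have Re_E_nonneg: "0 \<le> Re (E w)" if "Re (q w) \<ge> 0" for w
      using Re_powr_of_real_nonneg[OF that, of \<tau>] \<tau>_bounds C_nonneg by (simp add: E_def)
    show "\<forall>\<^sub>F w in at_infinity. Re (q w) > 0 \<longrightarrow> norm (h w) \<le> M * exp (Re (E w) + norm (q w) powr \<tau>')"
      using growth
    proof eventually_elim
      case (elim w)
      have "1 * exp (norm (q w) powr \<tau>') \<le> M * exp (Re (E w) + norm (q w) powr \<tau>')"
        if "Re (q w) > 0"
        using Re_E_nonneg[of w] that M_ge_1 by (intro mult_mono) auto
      with elim show ?case by auto
    qed
  qed (use hol_q M_ge_1 \<tau>'_less_1 Re_nonneg in auto)
  also have "\<dots> \<le> M * exp (norm (E z))"
    using M_ge_1 complex_Re_le_cmod by (intro mult_left_mono) auto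
  also have "norm (E z) = C * norm (q z) powr \<tau>"
    using C_nonneg by (simp add: E_def norm_mult norm_powr_real_powr')
  finally show ?thesis .
qed

lemma norm_le_mult_exp_if_eventually:
  fixes h :: "'a::{heine_borel,real_normed_vector} \<Rightarrow> 'b::real_normed_vector"
  assumes cont: "continuous_on UNIV h"
    and eventually_le: "\<forall>\<^sub>F z in at_infinity. P z \<longrightarrow> norm (h z) \<le> exp (k z)"
    and k_nonneg: "\<And>z. k z \<ge> 0"
  obtains M where "M \<ge> 1" "\<And>z. P z \<Longrightarrow> norm (h z) \<le> M * exp (k z)"
proof -
  obtain R where bound_beyond_R: "\<And>z. norm z \<ge> R \<Longrightarrow> P z \<Longrightarrow> norm (h z) \<le> exp (k z)"
    using eventually_le unfolding eventually_at_infinity by blast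
  have "bounded (h ` cball 0 R)"
    by (intro compact_imp_bounded compact_continuous_image continuous_on_subset[OF cont]) auto
  then obtain B where norm_le_B: "\<And>w. w \<in> h ` cball 0 R \<Longrightarrow> norm w \<le> B"
    unfolding bounded_iff by blast
  show thesis
  proof
    show "max 1 B \<ge> 1" by simp
    fix z assume "P z"
    then have "norm (h z) \<le> max 1 B * 1 \<or> norm (h z) \<le> 1 * exp (k z)"
      using norm_le_B[of "h z"] bound_beyond_R[of z] by (cases "norm z \<le> R") auto
    moreover have "max 1 B * 1 \<le> max 1 B * exp (k z)" "1 * exp (k z) \<le> max 1 B * exp (k z)"
      using k_nonneg[of z] by (intro mult_mono; simp)+
    ultimately show "norm (h z) \<le> max 1 B * exp (k z)" by linarith
  qed
qed

lemma Phragmen_Lindelof_Re_eq_0: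
  fixes h q :: "complex \<Rightarrow> complex" and \<tau> \<tau>' K :: real
  assumes hol_h: "h holomorphic_on UNIV"
    and hol_q: "q holomorphic_on UNIV" "filterlim q at_infinity at_infinity"
    and \<tau>_bounds: "0 < \<tau>" "\<tau> < 1" and \<tau>'_less_1: "\<tau>' < 1" and K_nonneg: "K \<ge> 0"
    and growth: "\<forall>\<^sub>F z in at_infinity. norm (h z) \<le> exp (norm (q z) powr \<tau>')"
    and critical: "\<forall>\<^sub>F z in at_infinity. Re (q z) = 0 \<longrightarrow> norm (h z) \<le> exp (K * norm (q z) powr \<tau>)"
  obtains M C where "M \<ge> 1" "C \<ge> 0" "\<And>z. norm (h z) \<le> M * exp (C * norm (q z) powr \<tau>)"
proof -
  obtain M where M_ge_1: "M \<ge> 1"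
    and critical_bound: "\<And>z. Re (q z) = 0 \<Longrightarrow> norm (h z) \<le> M * exp (K * norm (q z) powr \<tau>)"
    using norm_le_mult_exp_if_eventually[OF _ critical] holomorphic_on_imp_continuous_on[OF hol_h]
      K_nonneg by auto
  define C where "C = K / cos (\<tau> * pi / 2)"
  have cos_pos: "cos (\<tau> * pi / 2) > 0" using \<tau>_bounds by (intro cos_gt_zero) auto
  with K_nonneg have C_nonneg: "C \<ge> 0" by (simp add: C_def)
  have critical': "norm (h z) \<le> M * exp (C * cos (\<tau> * pi / 2) * norm (q z) powr \<tau>)"
    if "Re (q z) = 0" for z
    using critical_bound[OF that] cos_pos by (simp add: C_def)
  have "norm (h z) \<le> M * exp (C * norm (q z) powr \<tau>)" for z
  proof (cases "Re (q z) \<ge> 0")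
    case True
    show ?thesis
      by (rule Phragmen_Lindelof_exp_powr[OF hol_h hol_q \<tau>_bounds \<tau>'_less_1 M_ge_1 C_nonneg growth
            critical' True])
  next
    case False
    have "filterlim (\<lambda>z. - q z) at_infinity at_infinity"
      using hol_q(2) by (simp add: filterlim_at_infinity_conv_norm_at_top)
    then show ?thesis
      using Phragmen_Lindelof_exp_powr[of h "\<lambda>z. - q z" \<tau> \<tau>' M C z] hol_h hol_q(1) \<tau>_bounds
        \<tau>'_less_1 M_ge_1 C_nonneg growth critical' False
      by (simp add: holomorphic_on_minus)
  qed
  with M_ge_1 C_nonneg show thesis by (rule that)
qed

lemma eventually_norm_le_exp_poly_powr:
  fixes p :: "complex poly"
  assumes cont: "continuous_on UNIV h" and order: "entire_order h < ereal (degree p)"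
  obtains \<tau> where "\<tau> < 1" "\<forall>\<^sub>F z in at_infinity. norm (h z) \<le> exp (norm (poly p z) powr \<tau>)"
proof -
  have "0 < ereal (degree p)" using entire_order_nonneg order by (rule le_less_trans)
  then have degree_pos: "degree p > 0" by simp
  obtain \<rho> where \<rho>_bounds: "entire_order h < ereal \<rho>" "\<rho> < degree p"
    using ereal_dense2[OF order] by auto
  obtain \<rho>' where \<rho>'_bounds: "\<rho> < \<rho>'" "\<rho>' < degree p" using dense[OF \<rho>_bounds(2)] by auto
  have "(\<lambda>z::complex. norm z powr \<rho>) \<in> o[at_infinity](\<lambda>z. norm z powr \<rho>')"
    using \<rho>'_bounds
    by (subst powr_smallo_iff) (auto simp: filterlim_norm_at_top trivial_limit_at_infinity)
  also have "(\<lambda>z. norm z powr \<rho>') \<in> \<Theta>[at_infinity](\<lambda>z. norm (poly p z) powr (\<rho>' / degree p))"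
    using norm_poly_powr_bigtheta[OF degree_pos] by (simp add: bigtheta_sym)
  finally have "\<forall>\<^sub>F z in at_infinity. norm z powr \<rho> \<le> norm (poly p z) powr (\<rho>' / degree p)"
    by (auto dest: landau_o.smallD[OF _ zero_less_one])
  with eventually_norm_le_exp_powr_if_entire_order_less[OF cont \<rho>_bounds(1)]
  have "\<forall>\<^sub>F z in at_infinity. norm (h z) \<le> exp (norm (poly p z) powr (\<rho>' / degree p))"
    by eventually_elim (meson exp_le_cancel_iff order_trans)
  moreover have "\<rho>' / degree p < 1" using \<rho>'_bounds(2) degree_pos by simp
  ultimately show thesis by (intro that)
qed

lemma entire_order_le_if_bound_on_Re_poly_eq_0:
  fixes h :: "complex \<Rightarrow> complex" and p :: "complex poly"
  assumes hol_h: "h holomorphic_on UNIV" and order: "entire_order h < ereal (degree p)"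
    and \<sigma>_pos: "\<sigma> > 0"
    and critical: "\<forall>\<^sub>F z in at_infinity. Re (poly p z) = 0 \<longrightarrow> norm (h z) \<le> exp (norm z powr \<sigma>)"
  shows "entire_order h \<le> ereal \<sigma>"
proof (cases "\<sigma> < degree p")
  case False
  then have "ereal (degree p) \<le> ereal \<sigma>" by simp
  with order show ?thesis by (meson less_le_trans less_imp_le)
next
  case True
  then have degree_pos: "degree p > 0" using \<sigma>_pos by (intro gr0I) simp
  obtain \<tau> where \<tau>_less_1: "\<tau> < 1"
    and growth: "\<forall>\<^sub>F z in at_infinity. norm (h z) \<le> exp (norm (poly p z) powr \<tau>)"
    using eventually_norm_le_exp_poly_powr[OF holomorphic_on_imp_continuous_on[OF hol_h] order]
    by blast
  have bigo: "(\<lambda>z. norm z powr \<sigma>) \<in> O[at_infinity](\<lambda>z. norm (poly p z) powr (\<sigma> / degree p))"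
    "(\<lambda>z. norm (poly p z) powr (\<sigma> / degree p)) \<in> O[at_infinity](\<lambda>z. norm z powr \<sigma>)"
    using norm_poly_powr_bigtheta[OF degree_pos, of \<sigma>]
    by (auto simp: bigtheta_def bigomega_iff_bigo)
  obtain K where K_bound: "K > 0"
    "\<forall>\<^sub>F z in at_infinity. norm z powr \<sigma> \<le> K * norm (poly p z) powr (\<sigma> / degree p)"
    using landau_o.bigE[OF bigo(1)] by auto
  from K_bound(2) critical have critical':
    "\<forall>\<^sub>F z in at_infinity. Re (poly p z) = 0 \<longrightarrow>
      norm (h z) \<le> exp (K * norm (poly p z) powr (\<sigma> / degree p))"
    by eventually_elim (meson exp_le_cancel_iff order_trans)
  have poly_props: "poly p holomorphic_on UNIV" "filterlim (poly p) at_infinity at_infinity"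
    using degree_pos by (auto intro: holomorphic_intros filterlim_poly_at_infinity)
  obtain M C where M_ge_1: "M \<ge> 1" and C_nonneg: "C \<ge> 0"
    and global_bound: "\<And>z. norm (h z) \<le> M * exp (C * norm (poly p z) powr (\<sigma> / degree p))"
    using Phragmen_Lindelof_Re_eq_0[OF hol_h poly_props _ _ _ _ growth critical']
      \<sigma>_pos True \<tau>_less_1 K_bound(1)
    by auto
  obtain c where
    "\<forall>\<^sub>F z in at_infinity. norm (poly p z) powr (\<sigma> / degree p) \<le> c * norm z powr \<sigma>"
    using landau_o.bigE[OF bigo(2)] by auto
  then have "\<forall>\<^sub>F z in at_infinity. norm (h z) \<le> M * exp (C * c * norm z powr \<sigma>)"
  proof eventually_elim
    case (elim z)
    then have "C * norm (poly p z) powr (\<sigma> / degree p) \<le> C * c * norm z powr \<sigma>"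
      using mult_left_mono[OF elim C_nonneg] by (simp add: mult.assoc)
    then have "M * exp (C * norm (poly p z) powr (\<sigma> / degree p)) \<le> M * exp (C * c * norm z powr \<sigma>)"
      using M_ge_1 by (intro mult_left_mono) auto
    with global_bound[of z] show ?case by linarith
  qed
  with \<sigma>_pos show ?thesis by (rule entire_order_le)
qed

subsection \<open>The differential equation\<close>

lemma norm_coefficient_le:
  fixes h1 h0 q1 q0 f df ddf :: complex
  assumes ode: "ddf + h1 * exp q1 * df + h0 * exp q0 * f = 0" and "f \<noteq> 0"
  shows "norm h0 \<le> (norm (ddf / f) + norm h1 * exp (Re q1) * norm (df / f)) * exp (- Re q0)"
proof -
  have "h0 * exp q0 * f = - (ddf + h1 * exp q1 * df)"
    using ode by (simp add: add_eq_0_iff)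
  then have "h0 * exp q0 = - (ddf / f + h1 * exp q1 * (df / f))"
    using \<open>f \<noteq> 0\<close> by (simp add: field_simps)
  then have "norm h0 * exp (Re q0) = norm (ddf / f + h1 * exp q1 * (df / f))"
    by (metis norm_exp_eq_Re norm_minus_cancel norm_mult)
  also have "\<dots> \<le> norm (ddf / f) + norm h1 * exp (Re q1) * norm (df / f)"
    by (metis norm_exp_eq_Re norm_mult norm_triangle_ineq)
  finally show ?thesis by (simp add: exp_minus divide_inverse[symmetric] pos_le_divide_eq)
qed

lemma norm_coefficient_le_near_Re_eq_0:
  fixes P1 P0 :: "complex poly" and h1 h0 f :: "complex \<Rightarrow> complex" and c s :: real
  assumes ode: "\<And>z. deriv (deriv f) z + h1 z * exp (poly P1 z) * deriv f z
      + h0 z * exp (poly P0 z) * f z = 0"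
    and hol_h0: "h0 holomorphic_on UNIV"
    and P1_eq: "\<And>z. poly P1 z = of_real c * poly P0 z + k"
    and z0_critical: "Re (poly P0 z0) = 0"
    and near: "\<And>z. z \<in> sphere z0 s \<Longrightarrow> norm (poly P0 z - poly P0 z0) \<le> 1"
    and h1_le: "\<And>z. z \<in> sphere z0 s \<Longrightarrow> norm (h1 z) \<le> B"
    and logderivs: "\<And>z. z \<in> sphere z0 s \<Longrightarrow> logderivs_le f U z"
    and "s \<ge> 0"
  shows "norm (h0 z0) \<le> (U + B * exp (\<bar>c\<bar> + norm k) * U) * exp 1"
proof (rule maximum_modulus_cball[of h0 z0 s])
  show "h0 holomorphic_on cball z0 s" using hol_h0 by (rule holomorphic_on_subset) simp
  show "z0 \<in> cball z0 s" using \<open>s \<ge> 0\<close> by simp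
  fix z assume z_on_circle: "z \<in> sphere z0 s"
  have Re_P0: "\<bar>Re (poly P0 z)\<bar> \<le> 1"
    using abs_Re_le_cmod[of "poly P0 z - poly P0 z0"] near[OF z_on_circle] z0_critical by simp
  have "c * Re (poly P0 z) \<le> \<bar>c * Re (poly P0 z)\<bar>" by (rule abs_ge_self)
  also have "\<dots> \<le> \<bar>c\<bar>" using Re_P0 by (simp add: abs_mult mult_left_le)
  finally have Re_P1: "Re (poly P1 z) \<le> \<bar>c\<bar> + norm k"
    using complex_Re_le_cmod[of k] by (simp add: P1_eq)
  have "0 \<le> B" "0 \<le> U"
    using h1_le[OF z_on_circle] logderivs[OF z_on_circle] norm_ge_zero order_trans
    unfolding logderivs_le_def by blast+
  have "norm (h0 z) \<le> (norm (deriv (deriv f) z / f z)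
      + norm (h1 z) * exp (Re (poly P1 z)) * norm (deriv f z / f z)) * exp (- Re (poly P0 z))"
    using logderivs[OF z_on_circle] by (intro norm_coefficient_le ode) (simp add: logderivs_le_def)
  also have "\<dots> \<le> (U + B * exp (\<bar>c\<bar> + norm k) * U) * exp 1"
    using logderivs[OF z_on_circle] h1_le[OF z_on_circle] Re_P0 Re_P1 \<open>0 \<le> B\<close> \<open>0 \<le> U\<close>
    by (intro mult_mono add_mono) (auto simp: logderivs_le_def)
  finally show "norm (h0 z) \<le> (U + B * exp (\<bar>c\<bar> + norm k) * U) * exp 1" .
qed

lemma eventually_norm_coefficient_le_on_Re_eq_0:
  fixes P1 P0 :: "complex poly" and h1 h0 f :: "complex \<Rightarrow> complex" and c \<sigma> \<sigma>' :: real
  assumes ode: "\<And>z. deriv (deriv f) z + h1 z * exp (poly P1 z) * deriv f z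
      + h0 z * exp (poly P0 z) * f z = 0"
    and f_props: "f holomorphic_on UNIV" "f p \<noteq> 0" "entire_order f \<noteq> \<infinity>"
    and hol_h0: "h0 holomorphic_on UNIV"
    and P1_eq: "\<And>z. poly P1 z = of_real c * poly P0 z + k"
    and \<sigma>_bounds: "0 < \<sigma>" "\<sigma> < \<sigma>'"
    and h1_growth: "\<forall>\<^sub>F z in at_infinity. norm (h1 z) \<le> exp (norm z powr \<sigma>)"
  shows "\<forall>\<^sub>F z in at_infinity. Re (poly P0 z) = 0 \<longrightarrow> norm (h0 z) \<le> exp (norm z powr \<sigma>')"
proof -
  let ?B = "\<lambda>t. exp ((1 + t) powr \<sigma>)"
  obtain L where circle: "\<forall>\<^sub>F z0 in at_infinity.
      \<exists>s>0. s * norm z0 ^ degree P0 \<le> 1 \<and> (\<forall>z\<in>sphere z0 s. logderivs_le f (norm z0 ^ L) z)"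
    using eventually_exists_circle_logderivs_le_power[OF f_props] by blast
  let ?bound = "\<lambda>t. (t ^ L + ?B t * exp (\<bar>c\<bar> + norm k) * t ^ L) * exp 1"
  have "\<forall>\<^sub>F t in at_top. ?bound t \<le> exp (t powr \<sigma>') \<and> t \<ge> 1"
    using \<sigma>_bounds eventually_ge_at_top by (intro eventually_conj) (real_asymp, blast)
  then have "\<forall>\<^sub>F z0::complex in at_infinity.
      ?bound (norm z0) \<le> exp (norm z0 powr \<sigma>') \<and> norm z0 \<ge> 1"
    by (rule eventually_compose_filterlim[OF _ filterlim_norm_at_top])
  then show ?thesis
    using circle eventually_at_infinity_cball[OF h1_growth, of 1]
      eventually_norm_poly_diff_le[of P0]
  proof (eventually_elim, intro impI)
    fix z0
    assume z0_large: "?bound (norm z0) \<le> exp (norm z0 powr \<sigma>') \<and> norm z0 \<ge> 1"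
      and h1_le: "\<forall>z\<in>cball z0 1. norm (h1 z) \<le> exp (norm z powr \<sigma>)"
      and P0_diff_le: "\<forall>z. norm (z - z0) \<le> 1 \<longrightarrow>
        norm (poly P0 z - poly P0 z0) \<le> norm z0 ^ degree P0 * norm (z - z0)"
      and "Re (poly P0 z0) = 0"
      and "\<exists>s>0. s * norm z0 ^ degree P0 \<le> 1 \<and> (\<forall>z\<in>sphere z0 s. logderivs_le f (norm z0 ^ L) z)"
    then obtain s where s_bounds: "0 < s" "s * norm z0 ^ degree P0 \<le> 1"
      and logderivs: "\<And>z. z \<in> sphere z0 s \<Longrightarrow> logderivs_le f (norm z0 ^ L) z"
      by blast
    have "s * 1 \<le> s * norm z0 ^ degree P0"
      using z0_large s_bounds(1) by (intro mult_left_mono one_le_power) auto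
    with s_bounds(2) have "s \<le> 1" by linarith
    have "norm (h0 z0) \<le> ?bound (norm z0)"
    proof (rule norm_coefficient_le_near_Re_eq_0[OF ode hol_h0 P1_eq _ _ _ logderivs])
      fix z assume "z \<in> sphere z0 s"
      then have z_near: "norm (z - z0) = s" "z \<in> cball z0 1"
        using \<open>s \<le> 1\<close> by (auto simp: dist_norm norm_minus_commute)
      show "norm (poly P0 z - poly P0 z0) \<le> 1"
        using P0_diff_le z_near(1) s_bounds(2) \<open>s \<le> 1\<close> by (fastforce simp: mult.commute)
      have "norm z powr \<sigma> \<le> (1 + norm z0) powr \<sigma>"
        using z_near(1) \<open>s \<le> 1\<close> \<sigma>_bounds norm_triangle_ineq2[of z z0] by (intro powr_mono2) auto
      then show "norm (h1 z) \<le> ?B (norm z0)"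
        using h1_le z_near(2) by (meson exp_le_cancel_iff order_trans)
    qed (use s_bounds \<open>Re (poly P0 z0) = 0\<close> in auto)
    with z0_large show "norm (h0 z0) \<le> exp (norm z0 powr \<sigma>')" by linarith
  qed
qed

proposition entire_order_coefficient_le:
  fixes P1 P0 :: "complex poly" and h1 h0 f :: "complex \<Rightarrow> complex" and c :: real
  assumes ode: "\<And>z. deriv (deriv f) z + h1 z * exp (poly P1 z) * deriv f z
      + h0 z * exp (poly P0 z) * f z = 0"
    and f_props: "f holomorphic_on UNIV" "f p \<noteq> 0" "entire_order f \<noteq> \<infinity>"
    and hol: "h1 holomorphic_on UNIV" "h0 holomorphic_on UNIV"
    and degree_diff: "degree (P1 - smult (complex_of_real c) P0) = 0"
    and order: "entire_order h0 < ereal (degree P0)"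
  shows "entire_order h0 \<le> entire_order h1"
proof (rule ccontr)
  assume "\<not> ?thesis"
  then have "entire_order h1 < entire_order h0" by simp
  then obtain \<sigma> where \<sigma>_between: "entire_order h1 < ereal \<sigma>" "ereal \<sigma> < entire_order h0"
    using ereal_dense2 by blast
  obtain \<sigma>' where \<sigma>'_between: "ereal \<sigma> < ereal \<sigma>'" "ereal \<sigma>' < entire_order h0"
    using ereal_dense2[OF \<sigma>_between(2)] by blast
  have "0 < ereal \<sigma>" using entire_order_nonneg \<sigma>_between(1) by (rule le_less_trans)
  then have pos: "0 < \<sigma>" "\<sigma> < \<sigma>'" using \<sigma>'_between(1) by simp_all
  obtain k where "P1 - smult (complex_of_real c) P0 = [:k:]"
    using degree_diff by (rule degree_eq_zeroE)
  then have "P1 = smult (complex_of_real c) P0 + [:k:]" by (simp add: diff_eq_eq add.commute)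
  then have P1_eq: "poly P1 z = of_real c * poly P0 z + k" for z by simp
  have "\<forall>\<^sub>F z in at_infinity. norm (h1 z) \<le> exp (norm z powr \<sigma>)"
    using hol(1) \<sigma>_between(1)
    by (intro eventually_norm_le_exp_powr_if_entire_order_less holomorphic_on_imp_continuous_on)
  then have "\<forall>\<^sub>F z in at_infinity. Re (poly P0 z) = 0 \<longrightarrow> norm (h0 z) \<le> exp (norm z powr \<sigma>')"
    by (rule eventually_norm_coefficient_le_on_Re_eq_0[OF ode f_props hol(2) P1_eq pos])
  then have "entire_order h0 \<le> ereal \<sigma>'"
    using pos by (intro entire_order_le_if_bound_on_Re_poly_eq_0[OF hol(2) order]) auto
  with \<sigma>'_between(2) show False by simp
qed

theorem theorem3:
  fixes P1 P0 :: "complex poly" and h1 h0 f :: "complex \<Rightarrow> complex" and n :: nat and c :: real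
  assumes "n \<ge> 1"
    and "degree P1 = n" and "degree P0 = n"
    and "h1 holomorphic_on UNIV" and "h0 holomorphic_on UNIV"
    and "\<exists>z. h1 z \<noteq> 0" and "\<exists>z. h0 z \<noteq> 0"
    and "entire_order h1 < ereal (real (degree P1))"
    and "entire_order h0 < ereal (real (degree P0))"
    and "c \<ge> 1" and "degree (P1 - smult (complex_of_real c) P0) = 0"
    and "entire_order h1 < entire_lower_order h0"
    and "entire_lower_order h0 \<le> ereal (1/2)"
    and "f holomorphic_on UNIV"
    and "\<And>z. deriv (deriv f) z + h1 z * exp (poly P1 z) * deriv f z
               + h0 z * exp (poly P0 z) * f z = 0"
    and "\<exists>z. f z \<noteq> 0"
  shows "entire_order f = \<infinity>"
proof (rule ccontr)
  assume "entire_order f \<noteq> \<infinity>"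
  moreover obtain p where "f p \<noteq> 0" using assms(16) by blast
  ultimately have "entire_order h0 \<le> entire_order h1"
    using entire_order_coefficient_le[OF assms(15,14) _ _ assms(4,5,11,9)] by blast
  also have "\<dots> < entire_lower_order h0" by (rule assms(12))
  also have "\<dots> \<le> entire_order h0" by (rule entire_lower_order_le_entire_order)
  finally show False by simp
qed

end
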